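(* $\{1+\eta,\ \eta+1\}\equiv_c\{\hat{\mathcal{E}}_1,\hat{\mathcal{E}}_2\}\equiv_c\{\mathcal{E}_1,\mathcal{E}_2\}$.
   Context: Structures have domains contained in $\omega$; a class is identified with all isomorphic copies of its members; $\{\mathcal{A},\mathcal{B}\}$ denotes the class of all copies of $\mathcal{A}$ and $\mathcal{B}$. An enumeration operator $\Gamma$ is a c.e. set of pairs $(\alpha,\varphi)$ with $\alpha$ a finite set of basic sentences with constants from $\omega$ and $\varphi$ a basic sentence with constants from $\omega$; $\Gamma(\mathcal{S})=\{\varphi:(\alpha,\varphi)\in\Gamma,\ \alpha\subseteq D(\mathcal{S})\}$, $D(\mathcal{S})$ the atomic diagram. A computable embedding of $\mathcal{K}_0$ into $\mathcal{K}_1$ is an enumeration operator $\Gamma$ with $\Gamma(\mathcal{A})$ the atomic diagram of a structure in $\mathcal{K}_1$ for each $\mathcal{A}\in\mathcal{K}_0$, and $\mathcal{A}\cong\mathcal{B}$ iff $\Gamma(\mathcal{A})\cong\Gamma(\mathcal{B})$. For non-isomorphic $\mathcal{A},\mathcal{B}$, $\{\mathcal{A},\mathcal{B}\}\leq_c\{\mathcal{C},\mathcal{D}\}$ means there is such $\Gamma$ with $\Gamma(\mathcal{A})\cong\mathcal{C}$, $\Gamma(\mathcal{B})\cong\mathcal{D}$; $\equiv_c$ means $\leq_c$ in both directions. $\eta$ is the order type of the rationals; $1+\eta$ adds a least element, $\eta+1$ a greatest element. $\mathcal{E}_k$ is the equivalence structure with infinitely many equivalence classes of infinite size and exactly one equivalence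 class of size $k$; $\hat{\mathcal{E}}_k$ is the equivalence structure with infinitely many equivalence classes of infinite size and infinitely many equivalence classes of size $k$ (and no other classes). *)

theory Defs
  imports Complex_Main "HOL-Library.Nat_Bijection"
begin

section \<open>Computably enumerable sets\<close>

text \<open>Programs for the partial recursive functions. Arities are not recorded: a program is applied
  to an argument list, and it has no value when the length of the list does not suit it.\<close>

datatype recf =
    Zero
  | Succ
  | Proj nat
  | Comp recf "recf list"
  | PrimRec recf recf
  | Mu recf

inductive evaluates :: "recf \<Rightarrow> nat list \<Rightarrow> nat \<Rightarrow> bool" where
  Zero: "evaluates Zero xs 0"
| Succ: "evaluates Succ [x] (Suc x)"
| Proj: "i < length xs \<Longrightarrow> evaluates (Proj i) xs (xs ! i)"
| Comp: "list_all2 (\<lambda>g y. evaluates g xs y) gs ys \<Longrightarrow> evaluates f ys z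
    \<Longrightarrow> evaluates (Comp f gs) xs z"
| PrimRec_0: "evaluates f xs z \<Longrightarrow> evaluates (PrimRec f g) (0 # xs) z"
| PrimRec_Suc: "evaluates (PrimRec f g) (n # xs) y \<Longrightarrow> evaluates g (y # n # xs) z
    \<Longrightarrow> evaluates (PrimRec f g) (Suc n # xs) z"
| Mu: "evaluates f (n # xs) 0 \<Longrightarrow> (\<forall>m<n. \<exists>y>0. evaluates f (m # xs) y)
    \<Longrightarrow> evaluates (Mu f) xs n"

lemma evaluates_unique: "evaluates f xs y \<Longrightarrow> evaluates f xs z \<Longrightarrow> y = z"
proof (induction arbitrary: z rule: evaluates.induct)
  case (Zero xs)
  then show ?case by (auto elim: evaluates.cases)
next
  case (Succ x)
  then show ?case by (auto elim: evaluates.cases)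
next
  case (Proj i xs)
  from Proj(2) show ?case by (auto elim: evaluates.cases)
next
  case (Comp xs gs ys f w)
  from \<open>evaluates (Comp f gs) xs z\<close> obtain ys'
    where ys': "list_all2 (\<lambda>g y. evaluates g xs y) gs ys'" "evaluates f ys' z"
    by (auto elim: evaluates.cases)
  have "ys = ys'"
    using Comp.IH(1) ys'(1) by (auto simp: list_all2_conv_all_nth intro!: nth_equalityI)
  then show ?case using Comp.IH(2) ys'(2) by blast
next
  case (PrimRec_0 f xs w g)
  from PrimRec_0.prems have "evaluates f xs z" by (auto elim: evaluates.cases)
  then show ?case by (rule PrimRec_0.IH)
next
  case (PrimRec_Suc f g n xs y w)
  from PrimRec_Suc.prems obtain y'
    where y': "evaluates (PrimRec f g) (n # xs) y'" "evaluates g (y' # n # xs) z"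
    by (auto elim: evaluates.cases)
  show ?case using PrimRec_Suc.IH(1)[OF y'(1)] PrimRec_Suc.IH(2) y'(2) by blast
next
  case (Mu f n xs)
  from \<open>evaluates (Mu f) xs z\<close>
  have z: "evaluates f (z # xs) 0" "\<forall>m<z. \<exists>y>0. evaluates f (m # xs) y"
    by (auto elim: evaluates.cases)
  show ?case
  proof (rule linorder_cases[of n z])
    assume "n < z"
    then show ?thesis using z(2) Mu.IH(1) by fastforce
  next
    assume "z < n"
    then show ?thesis using z(1) Mu.IH(2) by fastforce
  qed simp
qed

definition ce :: "nat set \<Rightarrow> bool" where
  "ce X \<longleftrightarrow> (\<exists>f. X = {x. \<exists>y. evaluates f [x] y})"

section \<open>Structures and atomic diagrams\<close>

text \<open>Structures for a language with equality and one binary relation symbol, which is read as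
  \<open>\<le>\<close> in linear orders and as \<open>\<sim>\<close> in equivalence structures.\<close>

record 'a struct =
  universe :: "'a set"
  rel :: "('a \<times> 'a) set"

definition is_struct :: "'a struct \<Rightarrow> bool" where
  "is_struct S \<longleftrightarrow> universe S \<noteq> {} \<and> rel S \<subseteq> universe S \<times> universe S"

definition isomorphic :: "'a struct \<Rightarrow> 'b struct \<Rightarrow> bool" (infix "\<cong>" 50) where
  "S \<cong> T \<longleftrightarrow> (\<exists>f. bij_betw f (universe S) (universe T) \<and>
     (\<forall>x\<in>universe S. \<forall>y\<in>universe S. (x, y) \<in> rel S \<longleftrightarrow> (f x, f y) \<in> rel T))"

datatype atom = Eq nat nat | Rel nat nat

datatype basic = Pos atom | Neg atom

fun atom_constants :: "atom \<Rightarrow> nat set" where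
  "atom_constants (Eq a b) = {a, b}"
| "atom_constants (Rel a b) = {a, b}"

fun constants :: "basic \<Rightarrow> nat set" where
  "constants (Pos p) = atom_constants p"
| "constants (Neg p) = atom_constants p"

fun atom_true :: "nat struct \<Rightarrow> atom \<Rightarrow> bool" where
  "atom_true S (Eq a b) \<longleftrightarrow> a = b"
| "atom_true S (Rel a b) \<longleftrightarrow> (a, b) \<in> rel S"

fun basic_true :: "nat struct \<Rightarrow> basic \<Rightarrow> bool" where
  "basic_true S (Pos p) \<longleftrightarrow> atom_true S p"
| "basic_true S (Neg p) \<longleftrightarrow> \<not> atom_true S p"

text \<open>The universe may be a proper subset of \<^typ>\<open>nat\<close>; the diagram determines it, since
  \<open>a = a\<close> belongs to the diagram only for \<open>a\<close> in the universe.\<close>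

definition diagram :: "nat struct \<Rightarrow> basic set" where
  "diagram S = {\<phi>. constants \<phi> \<subseteq> universe S \<and> basic_true S \<phi>}"

lemma diagram_inject:
  assumes "is_struct S" "is_struct T" "diagram S = diagram T"
  shows "S = T"
proof -
  have "universe U = {a. Pos (Eq a a) \<in> diagram U}" for U
    by (auto simp: diagram_def)
  then have u: "universe S = universe T" using assms(3) by metis
  have "rel U = {(a, b). Pos (Rel a b) \<in> diagram U}" if "is_struct U" for U
    using that by (auto simp: diagram_def is_struct_def)
  then have "rel S = rel T" using assms by metis
  with u show ?thesis by simp
qed

section \<open>Enumeration operators and computable embeddings\<close>

fun atom_code :: "atom \<Rightarrow> nat" where
  "atom_code (Eq a b) = 2 * prod_encode (a, b)"
| "atom_code (Rel a b) = 2 * prod_encode (a, b) + 1"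

fun basic_code :: "basic \<Rightarrow> nat" where
  "basic_code (Pos p) = 2 * atom_code p"
| "basic_code (Neg p) = 2 * atom_code p + 1"

text \<open>Finite sets are coded by their canonical indices. The value of \<^const>\<open>set_encode\<close> is
  meaningful for finite sets only, hence the finiteness condition in \<open>enumeration_operator\<close>.\<close>

fun axiom_code :: "basic set \<times> basic \<Rightarrow> nat" where
  "axiom_code (\<alpha>, \<phi>) = prod_encode (set_encode (basic_code ` \<alpha>), basic_code \<phi>)"

definition enumeration_operator :: "(basic set \<times> basic) set \<Rightarrow> bool" where
  "enumeration_operator \<Gamma> \<longleftrightarrow> (\<forall>(\<alpha>, \<phi>)\<in>\<Gamma>. finite \<alpha>) \<and> ce (axiom_code ` \<Gamma>)"

definition apply_operator :: "(basic set \<times> basic) set \<Rightarrow> nat struct \<Rightarrow> basic set" where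
  "apply_operator \<Gamma> S = {\<phi>. \<exists>\<alpha>. (\<alpha>, \<phi>) \<in> \<Gamma> \<and> \<alpha> \<subseteq> diagram S}"

text \<open>\<open>produces \<Gamma> S T\<close> says that \<open>\<Gamma>(S)\<close> is (the atomic diagram of) the structure \<open>T\<close>. By
  \<open>diagram_inject\<close> there is at most one such \<open>T\<close>.\<close>

definition produces :: "(basic set \<times> basic) set \<Rightarrow> nat struct \<Rightarrow> nat struct \<Rightarrow> bool" where
  "produces \<Gamma> S T \<longleftrightarrow> is_struct T \<and> apply_operator \<Gamma> S = diagram T"

definition computable_embedding ::
    "(basic set \<times> basic) set \<Rightarrow> nat struct set \<Rightarrow> nat struct set \<Rightarrow> bool" where
  "computable_embedding \<Gamma> K\<^sub>0 K\<^sub>1 \<longleftrightarrow>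
     enumeration_operator \<Gamma> \<and>
     (\<forall>S\<in>K\<^sub>0. \<exists>T\<in>K\<^sub>1. produces \<Gamma> S T) \<and>
     (\<forall>S\<in>K\<^sub>0. \<forall>S'\<in>K\<^sub>0. \<forall>T T'. produces \<Gamma> S T \<longrightarrow> produces \<Gamma> S' T' \<longrightarrow>
        (S \<cong> S' \<longleftrightarrow> T \<cong> T'))"

text \<open>A pair \<open>(\<A>, \<B>)\<close> consists of two isomorphism types, each given as the class of all its copies
  with universe contained in \<^typ>\<open>nat\<close>. The class denoted by \<open>{\<A>, \<B>}\<close> is the union of the two.\<close>

type_synonym struct_pair = "nat struct set \<times> nat struct set"

fun reducible_c :: "struct_pair \<Rightarrow> struct_pair \<Rightarrow> bool" (infix "\<le>\<^sub>c" 50) where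
  "(\<A>, \<B>) \<le>\<^sub>c (\<C>, \<D>) \<longleftrightarrow>
     (\<exists>\<Gamma>. computable_embedding \<Gamma> (\<A> \<union> \<B>) (\<C> \<union> \<D>) \<and>
        (\<forall>S\<in>\<A>. \<exists>T\<in>\<C>. produces \<Gamma> S T) \<and>
        (\<forall>S\<in>\<B>. \<exists>T\<in>\<D>. produces \<Gamma> S T))"

definition equivalent_c :: "struct_pair \<Rightarrow> struct_pair \<Rightarrow> bool" (infix "\<equiv>\<^sub>c" 50) where
  "P \<equiv>\<^sub>c Q \<longleftrightarrow> P \<le>\<^sub>c Q \<and> Q \<le>\<^sub>c P"

section \<open>The structures\<close>

definition copies :: "'a struct \<Rightarrow> nat struct set" where
  "copies M = {S. is_struct S \<and> S \<cong> M}"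

definition order_eta :: "rat struct" where
  "order_eta = \<lparr>universe = UNIV, rel = {(x, y). x \<le> y}\<rparr>"

definition order_one :: "unit struct" where
  "order_one = \<lparr>universe = UNIV, rel = UNIV\<rparr>"

definition order_sum :: "'a struct \<Rightarrow> 'b struct \<Rightarrow> ('a + 'b) struct" where
  "order_sum S T =
     \<lparr>universe = Inl ` universe S \<union> Inr ` universe T,
      rel = {(Inl x, Inl y) | x y. (x, y) \<in> rel S} \<union>
            {(Inr x, Inr y) | x y. (x, y) \<in> rel T} \<union>
            {(Inl x, Inr y) | x y. x \<in> universe S \<and> y \<in> universe T}\<rparr>"

definition one_plus_eta :: "nat struct set" where
  "one_plus_eta = copies (order_sum order_one order_eta)"

definition eta_plus_one :: "nat struct set" where
  "eta_plus_one = copies (order_sum order_eta order_one)"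

definition equivalence_struct :: "'a struct \<Rightarrow> bool" where
  "equivalence_struct S \<longleftrightarrow> is_struct S \<and> equiv (universe S) (rel S)"

definition classes :: "'a struct \<Rightarrow> 'a set set" where
  "classes S = universe S // rel S"

text \<open>Since universes are subsets of \<^typ>\<open>nat\<close>, the conditions below determine the structures up to
  isomorphism. Finiteness is stated explicitly because \<^const>\<open>card\<close> is 0 on infinite sets.\<close>

definition E :: "nat \<Rightarrow> nat struct set" where
  "E k = {S. equivalence_struct S \<and>
     infinite {C \<in> classes S. infinite C} \<and>
     (\<exists>!C. C \<in> classes S \<and> finite C \<and> card C = k) \<and>
     (\<forall>C\<in>classes S. infinite C \<or> finite C \<and> card C = k)}"

definition E_hat :: "nat \<Rightarrow> nat struct set" where
  "E_hat k = {S. equivalence_struct S \<and>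
     infinite {C \<in> classes S. infinite C} \<and>
     infinite {C \<in> classes S. finite C \<and> card C = k} \<and>
     (\<forall>C\<in>classes S. infinite C \<or> finite C \<and> card C = k)}"

end

theory Submission
  imports Defs "HOL-Library.Countable_Set"
begin

text \<open>In all four reductions the output is a fixed decidable relation on \<open>\<omega>\<close>, restricted to a universe that
  is enumerated from positive information about the input. As finite classes have at most two elements,
  three pairwise distinct equivalent elements are a finite witness that a class is infinite.

  From \<open>1 + \<eta>\<close> or \<open>\<eta> + 1\<close>, build for every \<open>x\<close> classes that copy \<open>{y. y \<le> x}\<close> and classes that copy
  \<open>{0, 1} \<times> {y. x \<le> y}\<close>: only a least element gives size 1, only a greatest one gives size 2.

  From \<open>E_hat k\<close>, let \<open>x\<close> be the least number in a finite class and \<open>F\<close> the set of smaller elements. All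
  elements of \<open>F\<close> have infinite classes, so the pair \<open>(F, x)\<close> is a guess that is eventually issued, while
  every wrong guess is eventually refuted or has an infinite class at \<open>x\<close>. Giving each guess a class that
  copies the class of \<open>x\<close> and becomes infinite upon refutation yields \<open>E k\<close>. For the orders, the correct
  guess comes first in the lexicographic order of guesses. Each guess adds a final segment of a dense
  order to the output, with a least element that it loses when the guess is refuted or when the class of
  \<open>x\<close> turns out to have more than \<open>j\<close> elements. Guesses at classes with at least \<open>j = 1\<close> element yield
  the lower end of the output; those with \<open>j = 2\<close>, in reverse order, yield the upper end.\<close>

section \<open>A calculus of computable functions\<close>

text \<open>An operator sees finite parts of the input diagram and can never withdraw a sentence
  that it has put out. The relation between two output elements is therefore made to depend on their
  names alone, which settles negative sentences as well, and the only freedom left is to add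
  elements: a finite class may grow and an endpoint may be lost, never the reverse. So every guess
  starts out as if it were right, and refuting it can only mean spoiling the finite class or the
  endpoint that it created. Neither the finiteness of a class nor the absence of a number from the
  universe is ever confirmed. This is why a guess carries the set \<open>F\<close>: that all smaller
  elements have infinite classes becomes a finite conjunction of positive facts about
  \<open>F\<close>, and an omission from \<open>F\<close> is itself refuted by a positive fact. For
  effectiveness, premises are arbitrary finite sets of sentences. Every search through such a set is
  bounded by its code, so the sets of axioms are even decidable.\<close>

definition list_computable :: "nat \<Rightarrow> (nat list \<Rightarrow> nat) \<Rightarrow> bool" where
  "list_computable n F \<longleftrightarrow> (\<exists>f. \<forall>xs. length xs = n \<longrightarrow> evaluates f xs (F xs))"

lemma list_computable_nth: "i < n \<Longrightarrow> list_computable n (\<lambda>xs. xs ! i)"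
  unfolding list_computable_def by (metis evaluates.Proj)

lemma list_computable_0: "list_computable n (\<lambda>xs. 0)"
  unfolding list_computable_def by (metis evaluates.Zero)

lemma list_computable_Comp1:
  assumes "list_computable 1 (\<lambda>xs. H (xs ! 0))" "list_computable n F"
  shows "list_computable n (\<lambda>xs. H (F xs))"
proof -
  obtain h where h: "\<And>xs. length xs = 1 \<Longrightarrow> evaluates h xs (H (xs ! 0))"
    using assms(1) by (auto simp: list_computable_def)
  obtain f where f: "\<And>xs. length xs = n \<Longrightarrow> evaluates f xs (F xs)"
    using assms(2) by (auto simp: list_computable_def)
  have "evaluates (Comp h [f]) xs (H (F xs))" if "length xs = n" for xs
    using f[OF that] h[of "[F xs]"] by (auto intro!: evaluates.Comp[of xs _ "[F xs]"])
  then show ?thesis unfolding list_computable_def by blast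
qed

lemma list_computable_Comp2:
  assumes "list_computable 2 (\<lambda>xs. H (xs ! 0) (xs ! 1))" "list_computable n F" "list_computable n G"
  shows "list_computable n (\<lambda>xs. H (F xs) (G xs))"
proof -
  obtain h where h: "\<And>xs. length xs = 2 \<Longrightarrow> evaluates h xs (H (xs ! 0) (xs ! 1))"
    using assms(1) by (auto simp: list_computable_def)
  obtain f where f: "\<And>xs. length xs = n \<Longrightarrow> evaluates f xs (F xs)"
    using assms(2) by (auto simp: list_computable_def)
  obtain g where g: "\<And>xs. length xs = n \<Longrightarrow> evaluates g xs (G xs)"
    using assms(3) by (auto simp: list_computable_def)
  have "evaluates (Comp h [f, g]) xs (H (F xs) (G xs))" if "length xs = n" for xs
    using f[OF that] g[OF that] h[of "[F xs, G xs]"]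
    by (auto intro!: evaluates.Comp[of xs _ "[F xs, G xs]"])
  then show ?thesis unfolding list_computable_def by blast
qed

lemma list_computable_rec:
  assumes "list_computable n A" "list_computable (Suc (Suc n)) B"
  shows "list_computable (Suc n) (\<lambda>xs. rec_nat (A (tl xs)) (\<lambda>m y. B (y # m # tl xs)) (hd xs))"
proof -
  obtain a where a: "\<And>xs. length xs = n \<Longrightarrow> evaluates a xs (A xs)"
    using assms(1) by (auto simp: list_computable_def)
  obtain b where b: "\<And>xs. length xs = Suc (Suc n) \<Longrightarrow> evaluates b xs (B xs)"
    using assms(2) by (auto simp: list_computable_def)
  have "evaluates (PrimRec a b) (m # ys) (rec_nat (A ys) (\<lambda>m y. B (y # m # ys)) m)"
    if "length ys = n" for m ys
  proof (induction m)
    case (Suc m)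
    show ?case
      by (rule evaluates.PrimRec_Suc[OF Suc]) (use b[of "_ # m # ys"] that in simp)
  qed (simp add: evaluates.PrimRec_0 a that)
  then have "evaluates (PrimRec a b) xs (rec_nat (A (tl xs)) (\<lambda>m y. B (y # m # tl xs)) (hd xs))"
    if "length xs = Suc n" for xs
    using that by (cases xs) auto
  then show ?thesis unfolding list_computable_def by blast
qed

lemma list_computable_cong:
  assumes "list_computable n F" "\<And>xs. length xs = n \<Longrightarrow> F xs = G xs"
  shows "list_computable n G"
  using assms by (auto simp: list_computable_def)

lemma list_computable_Suc:
  assumes "list_computable n F" shows "list_computable n (\<lambda>xs. Suc (F xs))"
proof (rule list_computable_Comp1[OF _ assms])
  have "evaluates Succ xs (Suc (xs ! 0))" if "length xs = 1" for xs
    using that evaluates.Succ[of "hd xs"] by (cases xs) auto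
  then show "list_computable 1 (\<lambda>xs. Suc (xs ! 0))" unfolding list_computable_def by blast
qed

lemma length_2_conv: "length xs = 2 \<longleftrightarrow> (\<exists>x y. xs = [x, y])"
  by (auto simp: length_Suc_conv numeral_2_eq_2)

lemma list_computable_rec1:
  assumes B: "list_computable 2 (\<lambda>xs. B (xs ! 0) (xs ! 1))" and F: "list_computable n F"
  shows "list_computable n (\<lambda>xs. rec_nat 0 (\<lambda>m y. B y m) (F xs))"
proof (rule list_computable_Comp1[OF _ F])
  show "list_computable 1 (\<lambda>xs. rec_nat 0 (\<lambda>m y. B y m) (xs ! 0))"
    using list_computable_rec[where n = 0, OF list_computable_0] B
    by (fastforce simp: numeral_2_eq_2 length_Suc_conv intro: list_computable_cong)
qed

lemma list_computable_rec2:
  assumes A: "list_computable 1 (\<lambda>xs. A (xs ! 0))"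
    and B: "list_computable 3 (\<lambda>xs. B (xs ! 0) (xs ! 1) (xs ! 2))"
    and F: "list_computable n F" and G: "list_computable n G"
  shows "list_computable n (\<lambda>xs. rec_nat (A (G xs)) (\<lambda>m y. B y m (G xs)) (F xs))"
proof (rule list_computable_Comp2[OF _ F G])
  have "list_computable 2 (\<lambda>xs. rec_nat (A (tl xs ! 0))
      (\<lambda>m y. B ((y # m # tl xs) ! 0) ((y # m # tl xs) ! 1) ((y # m # tl xs) ! 2)) (hd xs))"
    using list_computable_rec[OF A, of "\<lambda>xs. B (xs ! 0) (xs ! 1) (xs ! 2)"] B
    by (simp only: numeral_3_eq_3 numeral_2_eq_2 One_nat_def)
  then show "list_computable 2 (\<lambda>xs. rec_nat (A (xs ! 1)) (\<lambda>m y. B y m (xs ! 1)) (xs ! 0))"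
    by (rule list_computable_cong) (auto simp: length_2_conv)
qed

lemma list_computable_add:
  assumes "list_computable n F" "list_computable n G"
  shows "list_computable n (\<lambda>xs. F xs + G xs)"
proof -
  have "x + k = rec_nat k (\<lambda>m. Suc) x" for x k :: nat by (induction x) auto
  then show ?thesis
    by (simp only:) (intro list_computable_rec2[where A = "\<lambda>x. x"] list_computable_nth list_computable_Suc assms; simp)
qed

lemma list_computable_mult:
  assumes "list_computable n F" "list_computable n G"
  shows "list_computable n (\<lambda>xs. F xs * G xs)"
proof -
  have "x * k = rec_nat 0 (\<lambda>m y. y + k) x" for x k :: nat by (induction x) auto
  then show ?thesis
    by (simp only:) (intro list_computable_rec2[where A = "\<lambda>x. 0"] list_computable_0
        list_computable_nth list_computable_add assms; simp)
qed

lemma list_computable_pred: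
  assumes "list_computable n F" shows "list_computable n (\<lambda>xs. F xs - 1)"
proof -
  have "k - 1 = rec_nat 0 (\<lambda>m y. m) k" for k :: nat by (cases k) auto
  then show ?thesis
    by (simp only:) (intro list_computable_rec1 list_computable_nth assms; simp)
qed

lemma list_computable_diff:
  assumes "list_computable n F" "list_computable n G"
  shows "list_computable n (\<lambda>xs. F xs - G xs)"
proof -
  have "rec_nat x (\<lambda>m y. y - 1) k = x - k" for x k :: nat by (induction k) auto
  then have "(\<lambda>xs. F xs - G xs) = (\<lambda>xs. rec_nat (F xs) (\<lambda>m y. y - 1) (G xs))" by simp
  then show ?thesis
    by (simp only:) (intro list_computable_rec2[where A = "\<lambda>x. x"] list_computable_nth
        list_computable_pred assms; simp)
qed

lemma list_computable_triangle:
  assumes "list_computable n F" shows "list_computable n (\<lambda>xs. triangle (F xs))"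
proof -
  have "triangle k = rec_nat 0 (\<lambda>m y. y + Suc m) k" for k :: nat by (induction k) auto
  then show ?thesis
    by (simp only:) (intro list_computable_rec1 list_computable_add list_computable_Suc
        list_computable_nth assms; simp)
qed

section \<open>Cantor pairing and its inverse\<close>

abbreviation pfst :: "nat \<Rightarrow> nat" where "pfst e \<equiv> fst (prod_decode e)"
abbreviation psnd :: "nat \<Rightarrow> nat" where "psnd e \<equiv> snd (prod_decode e)"

text \<open>The index of the diagonal of the Cantor pairing on which the pair coded by \<open>e\<close> lies.\<close>

primrec diagonal :: "nat \<Rightarrow> nat" where
  "diagonal 0 = 0"
| "diagonal (Suc e) = diagonal e + (1 - (triangle (Suc (diagonal e)) - Suc e))"

text \<open>The inner truncated difference in \<open>diagonal\<close> vanishes exactly when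
  \<open>Suc e\<close> has reached the next triangular number, so the outer one adds 1 at that
  moment and 0 before.\<close>

lemma triangle_diagonal: "triangle (diagonal e) \<le> e \<and> e < triangle (Suc (diagonal e))"
proof (induction e)
  case (Suc e)
  then show ?case by (cases "triangle (Suc (diagonal e)) \<le> Suc e") auto
qed auto

lemma triangle_mono: "m \<le> n \<Longrightarrow> triangle m \<le> triangle n"
  by (induction n) (auto simp: le_Suc_eq)

lemma diagonal_prod_encode: "diagonal (prod_encode (a, b)) = a + b"
proof -
  let ?e = "triangle (a + b) + a"
  have "\<not> diagonal ?e < a + b"
    using triangle_diagonal[of ?e] triangle_mono[of "Suc (diagonal ?e)" "a + b"] by auto
  moreover have "\<not> a + b < diagonal ?e"
    using triangle_diagonal[of ?e] triangle_mono[of "Suc (a + b)" "diagonal ?e"] by auto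
  ultimately show ?thesis by (simp add: prod_encode_def)
qed

text \<open>Arithmetic formulas for the projections, built from functions already known to be
  computable. A pair \<open>(a, b)\<close> lies at offset \<open>a\<close> on the diagonal
  \<open>a + b\<close>.\<close>

lemma pfst_eq: "pfst e = e - triangle (diagonal e)"
  and psnd_eq: "psnd e = diagonal e - pfst e"
proof -
  obtain a b where e: "e = prod_encode (a, b)" by (metis prod_decode_inverse surj_pair)
  have "diagonal e = a + b" by (simp add: e diagonal_prod_encode)
  moreover have "e = triangle (a + b) + a" by (simp add: e prod_encode_def)
  moreover have "pfst e = a" "psnd e = b" by (simp_all add: e)
  ultimately show "pfst e = e - triangle (diagonal e)" "psnd e = diagonal e - pfst e"
    by simp_all
qed

lemma list_computable_diagonal:
  assumes "list_computable n F" shows "list_computable n (\<lambda>xs. diagonal (F xs))"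
proof -
  have "diagonal k = rec_nat 0 (\<lambda>m y. y + (Suc 0 - (triangle (Suc y) - Suc m))) k" for k :: nat
    by (induction k) auto
  then show ?thesis
    by (simp only:) (intro list_computable_rec1 list_computable_add list_computable_diff
        list_computable_triangle list_computable_Suc list_computable_0 list_computable_nth assms; simp)
qed

section \<open>Computable functions and decidable predicates of one packed argument\<close>

text \<open>With pairing, one argument is enough: several variables are kept in one number, and the binders
  below (recursion, bounded quantifiers) extend this number by the value of the bound variable.\<close>

definition computable :: "(nat \<Rightarrow> nat) \<Rightarrow> bool" where
  "computable F \<longleftrightarrow> list_computable 1 (\<lambda>xs. F (xs ! 0))"

definition decidable :: "(nat \<Rightarrow> bool) \<Rightarrow> bool" where
  "decidable P \<longleftrightarrow> computable (\<lambda>e. of_bool (P e))"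

named_theorems computable_intros

lemma computable_id [computable_intros]: "computable (\<lambda>e. e)"
  unfolding computable_def by (rule list_computable_nth) simp

lemma computable_0: "computable (\<lambda>e. 0)"
  unfolding computable_def by (rule list_computable_0)

lemma computable_Suc [computable_intros]: "computable F \<Longrightarrow> computable (\<lambda>e. Suc (F e))"
  unfolding computable_def by (rule list_computable_Suc)

lemma computable_const [computable_intros]: "computable (\<lambda>e. c)"
  by (induction c) (auto intro: computable_0 computable_Suc)

lemma computable_add [computable_intros]:
  "computable F \<Longrightarrow> computable G \<Longrightarrow> computable (\<lambda>e. F e + G e)"
  unfolding computable_def by (rule list_computable_add)

lemma computable_mult [computable_intros]:
  "computable F \<Longrightarrow> computable G \<Longrightarrow> computable (\<lambda>e. F e * G e)"
  unfolding computable_def by (rule list_computable_mult)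

lemma computable_diff [computable_intros]:
  "computable F \<Longrightarrow> computable G \<Longrightarrow> computable (\<lambda>e. F e - G e)"
  unfolding computable_def by (rule list_computable_diff)

lemma computable_pfst [computable_intros]: "computable F \<Longrightarrow> computable (\<lambda>e. pfst (F e))"
  unfolding computable_def pfst_eq
  by (intro list_computable_diff list_computable_triangle list_computable_diagonal)

lemma computable_psnd [computable_intros]: "computable F \<Longrightarrow> computable (\<lambda>e. psnd (F e))"
  unfolding computable_def psnd_eq pfst_eq
  by (intro list_computable_diff list_computable_triangle list_computable_diagonal)

lemma list_computable_prod_encode:
  "list_computable n F \<Longrightarrow> list_computable n G \<Longrightarrow> list_computable n (\<lambda>xs. prod_encode (F xs, G xs))"
  unfolding prod_encode_def prod.case by (intro list_computable_add list_computable_triangle)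

lemma computable_prod_encode [computable_intros]:
  "computable F \<Longrightarrow> computable G \<Longrightarrow> computable (\<lambda>e. prod_encode (F e, G e))"
  unfolding computable_def by (rule list_computable_prod_encode)

lemma computable_comp: "computable F \<Longrightarrow> computable G \<Longrightarrow> computable (\<lambda>e. F (G e))"
  unfolding computable_def by (rule list_computable_Comp1)

lemma computable_rec:
  assumes N: "computable N" and A: "computable A"
    and B: "computable (\<lambda>e. B (pfst (pfst e)) (psnd (pfst e)) (psnd e))"
  shows "computable (\<lambda>e. rec_nat (A e) (\<lambda>m y. B m y e) (N e))"
proof -
  \<comment> \<open>Primitive recursion passes the previous value before the counter, whereas
    \<open>rec_nat\<close> passes the counter first; hence the swapped positions 1 and 0.\<close>
  have b: "list_computable 3 (\<lambda>xs. B (xs ! 1) (xs ! 0) (xs ! 2))"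
    using list_computable_Comp1[OF B[unfolded computable_def] list_computable_prod_encode[OF
      list_computable_prod_encode[OF list_computable_nth[of 1] list_computable_nth[of 0]] list_computable_nth[of 2]], of 3]
    by simp
  from list_computable_rec2[where F = "\<lambda>xs. N (xs ! 0)" and G = "\<lambda>xs. xs ! 0" and B = "\<lambda>y m. B m y", OF A[unfolded computable_def] b]
  show ?thesis using N by (simp add: computable_def list_computable_nth)
qed

lemma computable_power2 [computable_intros]:
  assumes "computable F" shows "computable (\<lambda>e. 2 ^ F e)"
proof -
  have "(2::nat) ^ n = rec_nat 1 (\<lambda>m y. 2 * y) n" for n by (induction n) auto
  then show ?thesis
    by (simp only:) (intro computable_rec computable_intros assms)
qed

lemma decidable_not [computable_intros]:
  assumes "decidable P" shows "decidable (\<lambda>e. \<not> P e)"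
proof -
  have "computable (\<lambda>e. 1 - of_bool (P e))"
    using assms unfolding decidable_def by (intro computable_intros)
  moreover have "(\<lambda>e. 1 - of_bool (P e) :: nat) = (\<lambda>e. of_bool (\<not> P e))" by auto
  ultimately show ?thesis by (simp add: decidable_def)
qed

lemma decidable_conj [computable_intros]:
  "decidable P \<Longrightarrow> decidable Q \<Longrightarrow> decidable (\<lambda>e. P e \<and> Q e)"
  unfolding decidable_def of_bool_conj by (intro computable_intros)

lemma decidable_disj [computable_intros]:
  "decidable P \<Longrightarrow> decidable Q \<Longrightarrow> decidable (\<lambda>e. P e \<or> Q e)"
  using decidable_not[OF decidable_conj[OF decidable_not[of P] decidable_not[of Q]]] by simp

lemma decidable_imp [computable_intros]:
  "decidable P \<Longrightarrow> decidable Q \<Longrightarrow> decidable (\<lambda>e. P e \<longrightarrow> Q e)"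
  using decidable_disj[OF decidable_not[of P], of Q] by simp

lemma decidable_iff [computable_intros]:
  "decidable P \<Longrightarrow> decidable Q \<Longrightarrow> decidable (\<lambda>e. P e \<longleftrightarrow> Q e)"
  using decidable_conj[OF decidable_imp[of P Q] decidable_imp[of Q P]]
  by (simp add: iff_conv_conj_imp[symmetric])

lemma decidable_le [computable_intros]:
  assumes "computable F" "computable G" shows "decidable (\<lambda>e. F e \<le> G e)"
proof -
  have "computable (\<lambda>e. 1 - (F e - G e))" by (intro computable_intros assms)
  moreover have "(\<lambda>e. 1 - (F e - G e)) = (\<lambda>e. of_bool (F e \<le> G e))" by auto
  ultimately show ?thesis by (simp add: decidable_def)
qed

lemma decidable_less [computable_intros]:
  "computable F \<Longrightarrow> computable G \<Longrightarrow> decidable (\<lambda>e. F e < G e)"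
  using decidable_not[OF decidable_le[of G F]] by (simp add: not_le)

lemma decidable_eq [computable_intros]:
  "computable F \<Longrightarrow> computable G \<Longrightarrow> decidable (\<lambda>e. F e = G e)"
  using decidable_conj[OF decidable_le[of F G] decidable_le[of G F]]
  by (simp add: order_eq_iff[symmetric])

lemma decidable_bex_less [computable_intros]:
  assumes N: "computable N" and P: "decidable (\<lambda>e. P (pfst e) (psnd e))"
  shows "decidable (\<lambda>e. \<exists>i<N e. P i e)"
proof -
  \<comment> \<open>The disjunction of two truth values \<open>p\<close> and \<open>y\<close>,
    written as \<open>p + y - p * y\<close>.\<close>
  let ?B = "\<lambda>m y e. of_bool (P m e) + y - of_bool (P m e) * y"
  have rec: "(of_bool (\<exists>i<n. P i e) :: nat) = rec_nat 0 (\<lambda>m y. ?B m y e) n" for n e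
  proof (induction n)
    case (Suc n)
    have "(\<exists>i<Suc n. P i e) \<longleftrightarrow> P n e \<or> (\<exists>i<n. P i e)" by (auto simp: less_Suc_eq)
    then show ?case unfolding nat.rec Suc[symmetric] by (simp only: of_bool_def) simp
  qed simp
  have "computable (\<lambda>e. of_bool (P (pfst (pfst e)) (psnd e)))"
    using computable_comp[OF P[unfolded decidable_def],
        of "\<lambda>e. prod_encode (pfst (pfst e), psnd e)"]
    by (simp add: computable_prod_encode computable_pfst computable_psnd computable_id)
  then have "computable (\<lambda>e. ?B (pfst (pfst e)) (psnd (pfst e)) (psnd e))"
    by (intro computable_intros)
  from computable_rec[OF N computable_const this] show ?thesis
    unfolding decidable_def rec .
qed

lemma decidable_ball_less [computable_intros]:
  assumes "computable N" "decidable (\<lambda>e. P (pfst e) (psnd e))"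
  shows "decidable (\<lambda>e. \<forall>i<N e. P i e)"
  using decidable_not[OF decidable_bex_less[OF assms(1) decidable_not[OF assms(2)]]] by simp

lemma decidable_comp: "decidable P \<Longrightarrow> computable G \<Longrightarrow> decidable (\<lambda>e. P (G e))"
  unfolding decidable_def by (rule computable_comp)

text \<open>The minimisation runs over a counter that the tested function ignores: the search stops
  at 0 if the test succeeds and never otherwise.\<close>

lemma ce_decidable:
  assumes "decidable P" shows "ce {x. P x}"
proof -
  have "list_computable 2 (\<lambda>xs. of_bool (\<not> P (xs ! 1)))"
    using decidable_not[OF assms] unfolding decidable_def computable_def
    by (rule list_computable_Comp1[where H = "\<lambda>x. of_bool (\<not> P x)"]) (simp add: list_computable_nth)
  then obtain f where "\<And>xs. length xs = 2 \<Longrightarrow> evaluates f xs (of_bool (\<not> P (xs ! 1)))"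
    unfolding list_computable_def by blast
  from this[of "[_, _]"] have f: "evaluates f [n, x] (of_bool (\<not> P x))" for n x by simp
  have "P x \<longleftrightarrow> (\<exists>y. evaluates (Mu f) [x] y)" for x
  proof
    assume "P x"
    then show "\<exists>y. evaluates (Mu f) [x] y"
      using f[of 0 x] by (auto intro!: exI[of _ 0] evaluates.Mu)
  next
    assume "\<exists>y. evaluates (Mu f) [x] y"
    then obtain y where "evaluates f [y, x] 0" by (auto elim: evaluates.cases)
    from evaluates_unique[OF this f] show "P x" by (cases "P x") auto
  qed
  then show ?thesis unfolding ce_def by auto
qed

section \<open>Binary codes of finite sets\<close>

lemma set_decode_power_le:
  assumes "i \<in> set_decode n" shows "2 ^ i \<le> n"
proof -
  have "odd (n div 2 ^ i)" using assms by (simp add: set_decode_def)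
  then show ?thesis by (metis div_less even_zero not_le)
qed

lemma set_decode_less:
  assumes "i \<in> set_decode n" shows "i < n"
  using less_exp set_decode_power_le[OF assms] by (rule less_le_trans)

text \<open>Bit \<open>b\<close> is set when the quotient by \<open>2 ^ b\<close> is odd. Naming
  quotient and remainder by bounded quantifiers leaves only sums, products and powers of 2, for
  which computability is available.\<close>

lemma set_decode_iff: "b \<in> set_decode s \<longleftrightarrow> (\<exists>q<Suc s. \<exists>r<2 ^ b. s = (2 * q + 1) * 2 ^ b + r)"
proof -
  have "odd (s div 2 ^ b) \<longleftrightarrow> (\<exists>q<Suc s. \<exists>r<2 ^ b. s = (2 * q + 1) * 2 ^ b + r)"
  proof
    assume "odd (s div 2 ^ b)"
    then obtain q where q: "s div 2 ^ b = 2 * q + 1" by (auto elim: oddE)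
    have "q \<le> s div 2 ^ b" using q by simp
    also have "\<dots> \<le> s" by simp
    finally have "q < Suc s" by simp
    moreover have "s = (2 * q + 1) * 2 ^ b + s mod 2 ^ b"
      by (metis q div_mult_mod_eq)
    ultimately show "\<exists>q<Suc s. \<exists>r<2 ^ b. s = (2 * q + 1) * 2 ^ b + r"
      by (metis mod_less_divisor zero_less_power zero_less_numeral)
  next
    assume "\<exists>q<Suc s. \<exists>r<2 ^ b. s = (2 * q + 1) * 2 ^ b + r"
    then obtain q r where "r < 2 ^ b" "s = (2 * q + 1) * 2 ^ b + r" by blast
    then have "s div 2 ^ b = 2 * q + 1" by (metis div_mult_self3 div_less add.right_neutral power_not_zero zero_neq_numeral)
    then show "odd (s div 2 ^ b)" by simp
  qed
  then show ?thesis by (simp add: set_decode_def)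
qed

lemma decidable_set_decode [computable_intros]:
  assumes "computable B" "computable S" shows "decidable (\<lambda>e. B e \<in> set_decode (S e))"
proof -
  have "decidable (\<lambda>e. pfst e \<in> set_decode (psnd e))"
    unfolding set_decode_iff by (intro computable_intros)
  from decidable_comp[OF this computable_prod_encode[OF assms]] show ?thesis by simp
qed

section \<open>Operators that restrict a fixed relation\<close>

text \<open>All operators used here output the restriction of a fixed decidable relation \<open>R\<close> on the natural
  numbers to a universe \<open>{u. U r u}\<close> that depends on the relation \<open>r\<close> of the input structure.\<close>

definition finitary :: "((nat \<times> nat) set \<Rightarrow> bool) \<Rightarrow> bool" where
  "finitary P \<longleftrightarrow> (\<forall>r. P r \<longleftrightarrow> (\<exists>r\<^sub>0\<subseteq>r. finite r\<^sub>0 \<and> P r\<^sub>0))"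

text \<open>Finitary predicates are the Scott-open sets of relations: monotone, and witnessed by
  finite parts. Hence they are closed under arbitrary existential but only finite universal
  quantification, and not under negation.\<close>

lemma finitaryI:
  assumes "\<And>r r'. P r \<Longrightarrow> r \<subseteq> r' \<Longrightarrow> P r'"
    and "\<And>r. P r \<Longrightarrow> \<exists>r\<^sub>0\<subseteq>r. finite r\<^sub>0 \<and> P r\<^sub>0"
  shows "finitary P"
  using assms unfolding finitary_def by blast

lemma finitary_mono: "finitary P \<Longrightarrow> P r \<Longrightarrow> r \<subseteq> r' \<Longrightarrow> P r'"
  unfolding finitary_def by (meson order_trans)

lemma finitary_finite: "finitary P \<Longrightarrow> P r \<Longrightarrow> \<exists>r\<^sub>0\<subseteq>r. finite r\<^sub>0 \<and> P r\<^sub>0"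
  unfolding finitary_def by blast

named_theorems finitary_intros

lemma finitary_const [finitary_intros]: "finitary (\<lambda>r. c)"
  by (rule finitaryI) auto

lemma finitary_mem [finitary_intros]: "finitary (\<lambda>r. p \<in> r)"
  by (rule finitaryI) (auto intro: exI[of _ "{p}"])

lemma finitary_disj [finitary_intros]:
  assumes "finitary P" "finitary Q" shows "finitary (\<lambda>r. P r \<or> Q r)"
proof (rule finitaryI)
  fix r r' assume "P r \<or> Q r" "r \<subseteq> r'"
  then show "P r' \<or> Q r'" by (metis assms finitary_mono)
next
  fix r assume "P r \<or> Q r"
  then show "\<exists>r\<^sub>0\<subseteq>r. finite r\<^sub>0 \<and> (P r\<^sub>0 \<or> Q r\<^sub>0)"
  proof
    assume "P r"
    from finitary_finite[OF assms(1) this] show ?thesis by blast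
  next
    assume "Q r"
    from finitary_finite[OF assms(2) this] show ?thesis by blast
  qed
qed

lemma finitary_conj [finitary_intros]:
  assumes "finitary P" "finitary Q" shows "finitary (\<lambda>r. P r \<and> Q r)"
proof (rule finitaryI)
  fix r r' assume "P r \<and> Q r" "r \<subseteq> r'"
  then show "P r' \<and> Q r'" by (metis assms finitary_mono)
next
  fix r assume "P r \<and> Q r"
  then obtain p q where pq: "p \<subseteq> r" "finite p" "P p" "q \<subseteq> r" "finite q" "Q q"
    by (metis assms finitary_finite)
  have "P (p \<union> q)" "Q (p \<union> q)"
    using finitary_mono[OF assms(1) pq(3)] finitary_mono[OF assms(2) pq(6)] by simp_all
  then show "\<exists>r\<^sub>0\<subseteq>r. finite r\<^sub>0 \<and> P r\<^sub>0 \<and> Q r\<^sub>0"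
    using pq by (intro exI[of _ "p \<union> q"]) simp
qed

lemma finitary_ex [finitary_intros]:
  assumes "\<And>x. finitary (P x)" shows "finitary (\<lambda>r. \<exists>x. P x r)"
proof (rule finitaryI)
  fix r r' assume "\<exists>x. P x r" "r \<subseteq> r'"
  then show "\<exists>x. P x r'" by (metis assms finitary_mono)
next
  fix r assume "\<exists>x. P x r"
  then obtain x where "P x r" by blast
  from finitary_finite[OF assms this] show "\<exists>r\<^sub>0\<subseteq>r. finite r\<^sub>0 \<and> (\<exists>x. P x r\<^sub>0)" by blast
qed

lemma finitary_imp_const [finitary_intros]: "finitary P \<Longrightarrow> finitary (\<lambda>r. c \<longrightarrow> P r)"
  by (cases c) (auto intro: finitary_const)

lemma finitary_ball_finite:
  assumes "finite A" "\<And>x. x \<in> A \<Longrightarrow> finitary (P x)" shows "finitary (\<lambda>r. \<forall>x\<in>A. P x r)"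
  using assms by (induction A rule: finite_induct) (auto intro: finitary_const finitary_conj)

lemma finitary_ball_less [finitary_intros]:
  "(\<And>x. finitary (P x)) \<Longrightarrow> finitary (\<lambda>r. \<forall>x<(n::nat). P x r)"
  using finitary_ball_finite[of "{..<n}" P] by (simp add: Ball_def)

section \<open>The operator and its output\<close>

definition positive_part :: "basic set \<Rightarrow> (nat \<times> nat) set" where
  "positive_part \<alpha> = {(x, y). Pos (Rel x y) \<in> \<alpha>}"

text \<open>Every finite set that by itself puts the constants of \<phi> into the universe serves as
  a premise. Whether a pair is an axiom can thus be read off from the pair alone, and a negative
  \<phi> is judged by the fixed relation.\<close>

definition restriction_operator ::
    "((nat \<times> nat) set \<Rightarrow> nat \<Rightarrow> bool) \<Rightarrow> (nat \<Rightarrow> nat \<Rightarrow> bool) \<Rightarrow> (basic set \<times> basic) set" where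
  "restriction_operator U R = {(\<alpha>, \<phi>). finite \<alpha> \<and> (\<forall>c\<in>constants \<phi>. U (positive_part \<alpha>) c) \<and>
     basic_true \<lparr>universe = UNIV, rel = {(u, v). R u v}\<rparr> \<phi>}"

definition restriction ::
    "((nat \<times> nat) set \<Rightarrow> nat \<Rightarrow> bool) \<Rightarrow> (nat \<Rightarrow> nat \<Rightarrow> bool) \<Rightarrow> nat struct \<Rightarrow> nat struct" where
  "restriction U R S = \<lparr>universe = {u. U (rel S) u},
     rel = {(u, v). U (rel S) u \<and> U (rel S) v \<and> R u v}\<rparr>"

lemma positive_part_diagram: "is_struct S \<Longrightarrow> positive_part (diagram S) = rel S"
  by (auto simp: positive_part_def diagram_def is_struct_def)

lemma finite_constants: "finite (constants \<phi>)"
  by (cases \<phi>; rename_tac p; case_tac p) auto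

lemma basic_true_restriction:
  assumes "\<forall>c\<in>constants \<phi>. U (rel S) c"
  shows "basic_true (restriction U R S) \<phi> \<longleftrightarrow> basic_true \<lparr>universe = UNIV, rel = {(u, v). R u v}\<rparr> \<phi>"
  using assms by (cases \<phi>; rename_tac p; case_tac p) (auto simp: restriction_def)

text \<open>A sentence has finitely many constants, and each enters the universe on account of
  finitely many related pairs. Written as positive sentences, these pairs form the premise of one
  axiom.\<close>

lemma produces_restriction:
  assumes U: "\<And>u. finitary (\<lambda>r. U r u)" and S: "is_struct S" and ne: "U (rel S) u"
  shows "produces (restriction_operator U R) S (restriction U R S)"
proof -
  have "apply_operator (restriction_operator U R) S = diagram (restriction U R S)"
  proof (intro set_eqI)
    fix \<phi>
    let ?fin = "\<lambda>r. \<forall>c\<in>constants \<phi>. U r c"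
    have fin: "finitary ?fin" by (rule finitary_ball_finite[OF finite_constants U])
    have "(\<exists>\<alpha>\<subseteq>diagram S. finite \<alpha> \<and> ?fin (positive_part \<alpha>)) \<longleftrightarrow> ?fin (rel S)"
    proof
      assume "\<exists>\<alpha>\<subseteq>diagram S. finite \<alpha> \<and> ?fin (positive_part \<alpha>)"
      then obtain \<alpha> where "\<alpha> \<subseteq> diagram S" "?fin (positive_part \<alpha>)" by blast
      moreover from this have "positive_part \<alpha> \<subseteq> rel S"
        by (auto simp: positive_part_diagram[OF S, symmetric]) (auto simp: positive_part_def)
      ultimately show "?fin (rel S)" using finitary_mono[OF fin] by blast
    next
      assume "?fin (rel S)"
      from finitary_finite[OF fin this] obtain r where r: "r \<subseteq> rel S" "finite r" "?fin r" by blast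
      let ?\<alpha> = "(\<lambda>(x, y). Pos (Rel x y)) ` r"
      have "positive_part ?\<alpha> = r" by (auto simp: positive_part_def)
      moreover have "?\<alpha> \<subseteq> diagram S" using r(1) S by (auto simp: diagram_def is_struct_def)
      ultimately show "\<exists>\<alpha>\<subseteq>diagram S. finite \<alpha> \<and> ?fin (positive_part \<alpha>)"
        using r by (intro exI[of _ ?\<alpha>]) simp
    qed
    moreover have "constants \<phi> \<subseteq> universe (restriction U R S) \<longleftrightarrow> ?fin (rel S)"
      by (auto simp: restriction_def)
    ultimately show "\<phi> \<in> apply_operator (restriction_operator U R) S \<longleftrightarrow> \<phi> \<in> diagram (restriction U R S)"
      using basic_true_restriction[of \<phi> U S R]
      by (auto simp: apply_operator_def restriction_operator_def diagram_def)
  qed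
  then show ?thesis
    using ne by (auto simp: produces_def is_struct_def restriction_def)
qed

text \<open>The number \<open>4 * prod_encode (x, y) + 2\<close> is the code of the sentence
  \<open>Pos (Rel x y)\<close>.\<close>

definition decode_rel :: "nat \<Rightarrow> (nat \<times> nat) set" where
  "decode_rel s = {(x, y). 4 * prod_encode (x, y) + 2 \<in> set_decode s}"

lemma inj_basic_code: "inj basic_code"
proof (rule injI)
  fix \<phi> \<psi> assume "basic_code \<phi> = basic_code \<psi>"
  moreover have "atom_code p = atom_code q \<Longrightarrow> p = q" for p q
    by (cases p; cases q; simp; presburger?)
  ultimately show "\<phi> = \<psi>"
    by (cases \<phi>; cases \<psi>; simp; presburger?)
qed

lemma surj_basic_code: "surj basic_code"
proof -
  have atom: "n \<in> range atom_code" for n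
  proof -
    obtain a b where ab: "n div 2 = prod_encode (a, b)" by (metis prod_decode_inverse surj_pair)
    have "n = atom_code (if even n then Eq a b else Rel a b)" using ab[symmetric] by simp
    then show ?thesis by blast
  qed
  have "n \<in> range basic_code" for n
  proof -
    obtain p where p: "n div 2 = atom_code p" using atom by blast
    have "n = basic_code (if even n then Pos p else Neg p)" using p[symmetric] by simp
    then show ?thesis by blast
  qed
  then show ?thesis by blast
qed

lemma decode_rel_basic_code:
  assumes "finite \<alpha>" shows "decode_rel (set_encode (basic_code ` \<alpha>)) = positive_part \<alpha>"
proof -
  have "4 * prod_encode (x, y) + 2 \<in> basic_code ` \<alpha> \<longleftrightarrow> Pos (Rel x y) \<in> \<alpha>" for x y
    using inj_image_mem_iff[OF inj_basic_code, of "Pos (Rel x y)" \<alpha>] by simp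
  then show ?thesis using assms by (auto simp: decode_rel_def positive_part_def)
qed

lemma enumeration_operator_restriction:
  assumes U: "decidable (\<lambda>e. U (decode_rel (pfst e)) (psnd e))"
    and R: "decidable (\<lambda>e. R (pfst e) (psnd e))"
  shows "enumeration_operator (restriction_operator U R)"
proof -
  \<comment> \<open>The code of a sentence is four times the coded pair of its constants plus
    \<open>k\<close>, where \<open>k\<close> = 0, 1, 2, 3 stands for equality, inequality, the
    relation and its negation.\<close>
  define Q where "Q s p \<longleftrightarrow> (\<exists>c<Suc p. \<exists>k<4. p = 4 * c + k \<and>
     U (decode_rel s) (pfst c) \<and> U (decode_rel s) (psnd c) \<and>
     (k = 0 \<and> pfst c = psnd c \<or> k = 1 \<and> \<not> pfst c = psnd c \<or>
      k = 2 \<and> R (pfst c) (psnd c) \<or> k = 3 \<and> \<not> R (pfst c) (psnd c)))" for s p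
  have U': "decidable (\<lambda>e. U (decode_rel (F e)) (G e))" if "computable F" "computable G" for F G
    using decidable_comp[OF U computable_prod_encode[OF that]] by simp
  have R': "decidable (\<lambda>e. R (F e) (G e))" if "computable F" "computable G" for F G
    using decidable_comp[OF R computable_prod_encode[OF that]] by simp
  have dec: "decidable (\<lambda>e. Q (pfst e) (psnd e))"
    unfolding Q_def by (intro computable_intros U' R')
  have Q: "(\<forall>c\<in>constants \<phi>. U (decode_rel s) c) \<and> basic_true \<lparr>universe = UNIV, rel = {(u, v). R u v}\<rparr> \<phi>
     \<longleftrightarrow> Q s (basic_code \<phi>)" for s \<phi>
  proof -
    have code: "basic_code \<phi> = 4 * c + k" if
      "\<phi> = (if k = 0 then Pos (Eq a b) else if k = 1 then Neg (Eq a b) else if k = 2 then Pos (Rel a b) else Neg (Rel a b))"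
      "c = prod_encode (a, b)" "k < 4" for a b c k
      using that by auto
    obtain a b k where \<phi>: "k < (4::nat)" "\<phi> = (if k = 0 then Pos (Eq a b) else if k = 1 then Neg (Eq a b)
        else if k = 2 then Pos (Rel a b) else Neg (Rel a b))"
    proof -
      have "\<exists>k<4::nat. \<exists>a b. \<phi> = (if k = 0 then Pos (Eq a b) else if k = 1 then Neg (Eq a b)
        else if k = 2 then Pos (Rel a b) else Neg (Rel a b))"
      proof (cases \<phi>)
        case (Pos p)
        then show ?thesis by (cases p) (force intro: exI[of _ 0] exI[of _ 2])+
      next
        case (Neg p)
        then show ?thesis by (cases p) (force intro: exI[of _ 1] exI[of _ 3])+
      qed
      then show ?thesis using that by blast
    qed
    have c: "basic_code \<phi> = 4 * prod_encode (a, b) + k" using code \<phi> by blast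
    have "Q s (basic_code \<phi>) \<longleftrightarrow> U (decode_rel s) a \<and> U (decode_rel s) b \<and>
       (k = 0 \<and> a = b \<or> k = 1 \<and> \<not> a = b \<or> k = 2 \<and> R a b \<or> k = 3 \<and> \<not> R a b)"
      (is "_ \<longleftrightarrow> ?W")
    proof
      assume "Q s (basic_code \<phi>)"
      then obtain d l where l: "l < 4" "basic_code \<phi> = 4 * d + l"
        and W: "U (decode_rel s) (pfst d)" "U (decode_rel s) (psnd d)"
          "l = 0 \<and> pfst d = psnd d \<or> l = 1 \<and> \<not> pfst d = psnd d \<or>
           l = 2 \<and> R (pfst d) (psnd d) \<or> l = 3 \<and> \<not> R (pfst d) (psnd d)"
        unfolding Q_def by blast
      have "d = prod_encode (a, b)" "l = k" using l c \<phi>(1) by presburger+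
      then show ?W using W by simp
    next
      assume ?W
      then show "Q s (basic_code \<phi>)"
        unfolding Q_def c using \<phi>(1)
        by (intro exI[of _ "prod_encode (a, b)"] exI[of _ k] conjI) simp_all
    qed
    then show ?thesis using \<phi> by auto
  qed
  have "axiom_code ` restriction_operator U R = {x. Q (pfst x) (psnd x)}"
  proof (intro set_eqI iffI)
    fix x assume "x \<in> axiom_code ` restriction_operator U R"
    then show "x \<in> {x. Q (pfst x) (psnd x)}"
      by (auto simp: restriction_operator_def Q[symmetric] decode_rel_basic_code)
  next
    fix x assume "x \<in> {x. Q (pfst x) (psnd x)}"
    then have q: "Q (pfst x) (psnd x)" by simp
    \<comment> \<open>Every number is the code of some sentence and every number codes a finite set
      of sentences, so each number that passes the test is the code of an axiom.\<close>
    obtain \<phi> where \<phi>: "psnd x = basic_code \<phi>" using surj_basic_code by (metis surjD)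
    define \<alpha> where "\<alpha> = basic_code -` set_decode (pfst x)"
    have fin: "finite \<alpha>" unfolding \<alpha>_def
      by (rule finite_vimageI[OF _ inj_basic_code]) simp
    have "basic_code ` \<alpha> = set_decode (pfst x)"
      unfolding \<alpha>_def by (rule surj_image_vimage_eq[OF surj_basic_code])
    then have enc: "set_encode (basic_code ` \<alpha>) = pfst x" by simp
    then have "x = axiom_code (\<alpha>, \<phi>)" using \<phi>[symmetric] by simp
    moreover have "(\<alpha>, \<phi>) \<in> restriction_operator U R"
      using q fin decode_rel_basic_code[OF fin] unfolding enc \<phi> Q[symmetric]
      by (simp add: restriction_operator_def)
    ultimately show "x \<in> axiom_code ` restriction_operator U R" by blast
  qed
  then show ?thesis
    using ce_decidable[OF dec] by (auto simp: enumeration_operator_def restriction_operator_def)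
qed

lemma decidable_decode_rel [computable_intros]:
  assumes "computable X" "computable Y" "computable S"
  shows "decidable (\<lambda>e. (X e, Y e) \<in> decode_rel (S e))"
  unfolding decode_rel_def mem_Collect_eq prod.case by (intro computable_intros assms)

lemma decode_rel_less:
  assumes "(x, y) \<in> decode_rel s" shows "x < s" "y < s"
proof -
  have "4 * prod_encode (x, y) + 2 < s"
    using assms by (intro set_decode_less) (simp add: decode_rel_def)
  then show "x < s" "y < s"
    using le_prod_encode_1[of x y] le_prod_encode_2[of y x] by simp_all
qed

text \<open>The conjunct with \<open>decode_rel\<close> guards the quantifier: entries of a coded
  relation are smaller than its code, so the search is bounded by \<open>S e\<close>.\<close>

lemma decidable_ex_decode_rel [computable_intros]:
  assumes X: "computable X" and S: "computable S" and P: "decidable (\<lambda>e. P (pfst e) (psnd e))"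
  shows "decidable (\<lambda>e. \<exists>y. (X e, y) \<in> decode_rel (S e) \<and> P y e)"
proof -
  have "decidable (\<lambda>e. (X (psnd e), pfst e) \<in> decode_rel (S (psnd e)))"
    by (intro computable_intros computable_comp[OF X] computable_comp[OF S])
  then have "decidable (\<lambda>e. \<exists>y<S e. (X e, y) \<in> decode_rel (S e) \<and> P y e)"
    by (intro decidable_bex_less[OF S] decidable_conj P)
  moreover have "(\<lambda>e. \<exists>y<S e. (X e, y) \<in> decode_rel (S e) \<and> P y e) =
      (\<lambda>e. \<exists>y. (X e, y) \<in> decode_rel (S e) \<and> P y e)"
    by (auto dest: decode_rel_less)
  ultimately show ?thesis by simp
qed

lemma decidable_ex_decode_rel_diagonal [computable_intros]:
  assumes S: "computable S" and P: "decidable (\<lambda>e. P (pfst e) (psnd e))"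
  shows "decidable (\<lambda>e. \<exists>x. (x, x) \<in> decode_rel (S e) \<and> P x e)"
proof -
  have "decidable (\<lambda>e. (pfst e, pfst e) \<in> decode_rel (S (psnd e)))"
    by (intro computable_intros computable_comp[OF S])
  then have "decidable (\<lambda>e. \<exists>x<S e. (x, x) \<in> decode_rel (S e) \<and> P x e)"
    by (intro decidable_bex_less[OF S] decidable_conj P)
  moreover have "(\<lambda>e. \<exists>x<S e. (x, x) \<in> decode_rel (S e) \<and> P x e) =
      (\<lambda>e. \<exists>x. (x, x) \<in> decode_rel (S e) \<and> P x e)"
    by (auto dest: decode_rel_less)
  ultimately show ?thesis by simp
qed

section \<open>Isomorphism\<close>

lemma isomorphic_sym:
  assumes "S \<cong> T" shows "T \<cong> S"
proof -
  obtain f where f: "bij_betw f (universe S) (universe T)"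
    "\<forall>x\<in>universe S. \<forall>y\<in>universe S. (x, y) \<in> rel S \<longleftrightarrow> (f x, f y) \<in> rel T"
    using assms by (auto simp: isomorphic_def)
  let ?g = "inv_into (universe S) f"
  have "(x, y) \<in> rel T \<longleftrightarrow> (?g x, ?g y) \<in> rel S" if "x \<in> universe T" "y \<in> universe T" for x y
    using f that by (simp add: bij_betw_inv_into_right inv_into_into bij_betw_imp_surj_on)
  then show ?thesis
    using bij_betw_inv_into[OF f(1)] by (auto simp: isomorphic_def)
qed

lemma isomorphic_trans:
  assumes "S \<cong> T" "T \<cong> V" shows "S \<cong> V"
proof -
  obtain f where f: "bij_betw f (universe S) (universe T)"
    "\<forall>x\<in>universe S. \<forall>y\<in>universe S. (x, y) \<in> rel S \<longleftrightarrow> (f x, f y) \<in> rel T"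
    using assms(1) by (auto simp: isomorphic_def)
  obtain g where g: "bij_betw g (universe T) (universe V)"
    "\<forall>x\<in>universe T. \<forall>y\<in>universe T. (x, y) \<in> rel T \<longleftrightarrow> (g x, g y) \<in> rel V"
    using assms(2) by (auto simp: isomorphic_def)
  have "\<forall>x\<in>universe S. f x \<in> universe T" using f(1) by (auto simp: bij_betw_def)
  then show ?thesis
    using bij_betw_trans[OF f(1) g(1)] f(2) g(2) by (auto simp: isomorphic_def)
qed

definition isomorphism_types :: "nat struct set \<Rightarrow> nat struct set \<Rightarrow> bool" where
  "isomorphism_types \<A> \<B> \<longleftrightarrow> (\<forall>S\<in>\<A> \<union> \<B>. is_struct S) \<and> (\<forall>S\<in>\<A>. \<forall>T\<in>\<A>. S \<cong> T) \<and>
     (\<forall>S\<in>\<B>. \<forall>T\<in>\<B>. S \<cong> T) \<and> (\<forall>S\<in>\<A>. \<forall>T\<in>\<B>. \<not> S \<cong> T)"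

text \<open>When each pair consists of two different isomorphism types, sending the first type into
  the first and the second into the second already makes the operator preserve and reflect
  isomorphism. That an output universe is nonempty is inherited from the target class.\<close>

lemma reducible_c_restriction:
  assumes AB: "isomorphism_types \<A> \<B>" and CD: "isomorphism_types \<C> \<D>"
    and fin: "\<And>u. finitary (\<lambda>r. U r u)"
    and U: "decidable (\<lambda>e. U (decode_rel (pfst e)) (psnd e))"
    and R: "decidable (\<lambda>e. R (pfst e) (psnd e))"
    and A: "\<And>S. S \<in> \<A> \<Longrightarrow> restriction U R S \<in> \<C>" and B: "\<And>S. S \<in> \<B> \<Longrightarrow> restriction U R S \<in> \<D>"
  shows "(\<A>, \<B>) \<le>\<^sub>c (\<C>, \<D>)"
proof -
  let ?\<Gamma> = "restriction_operator U R"
  have prod: "produces ?\<Gamma> S (restriction U R S)" if S: "S \<in> \<A> \<union> \<B>" for S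
  proof -
    have "is_struct (restriction U R S)"
      using S A B CD by (auto simp: isomorphism_types_def)
    then obtain u where "U (rel S) u" by (auto simp: is_struct_def restriction_def)
    then show ?thesis using produces_restriction[OF fin] AB S by (auto simp: isomorphism_types_def)
  qed
  have uniq: "T = restriction U R S" if "S \<in> \<A> \<union> \<B>" "produces ?\<Gamma> S T" for S T
    using prod[OF that(1)] that(2) by (auto simp: produces_def intro: diagram_inject)
  have iso: "S \<cong> S' \<longleftrightarrow> restriction U R S \<cong> restriction U R S'" if "S \<in> \<A> \<union> \<B>" "S' \<in> \<A> \<union> \<B>" for S S'
    using that AB CD A B unfolding isomorphism_types_def by (metis Un_iff isomorphic_sym)
  have "computable_embedding ?\<Gamma> (\<A> \<union> \<B>) (\<C> \<union> \<D>)"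
    unfolding computable_embedding_def
    using enumeration_operator_restriction[OF U R] prod uniq iso A B by blast
  then show ?thesis using prod A B by (auto intro!: exI[of _ ?\<Gamma>])
qed

section \<open>Equivalence structures\<close>

lemma isomorphic_if_bij_classes:
  assumes S: "equivalence_struct S" and T: "equivalence_struct T"
    and h: "bij_betw h (classes S) (classes T)"
    and f: "\<And>C. C \<in> classes S \<Longrightarrow> bij_betw (f C) C (h C)"
  shows "S \<cong> T"
proof -
  have eS: "equiv (universe S) (rel S)" and eT: "equiv (universe T) (rel T)"
    using S T by (simp_all add: equivalence_struct_def)
  define cl where "cl x = rel S `` {x}" for x
  define F where "F x = f (cl x) x" for x
  have cl: "cl x \<in> classes S" "x \<in> cl x" if "x \<in> universe S" for x
    using that equiv_class_self[OF eS] by (auto simp: cl_def classes_def quotientI)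
  have cl_eq: "cl x = C" if "C \<in> classes S" "x \<in> C" for x C
    using that eS unfolding cl_def classes_def by (metis Image_singleton_iff equiv_class_eq quotientE)
  have hT: "h C \<in> classes T" if "C \<in> classes S" for C
    using that h by (auto simp: bij_betw_def)
  have F: "F x \<in> h (cl x)" if "x \<in> universe S" for x
    using f[OF cl(1)[OF that]] cl(2)[OF that] by (auto simp: F_def bij_betw_def)
  have eq: "(F x, F y) \<in> rel T \<longleftrightarrow> cl x = cl y" if "x \<in> universe S" "y \<in> universe S" for x y
  proof -
    have "(F x, F y) \<in> rel T \<longleftrightarrow> h (cl x) = h (cl y)"
      using quotient_eq_iff[OF eT hT[OF cl(1), unfolded classes_def] hT[OF cl(1), unfolded classes_def]] F that
      by blast
    also have "\<dots> \<longleftrightarrow> cl x = cl y"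
      using inj_on_eq_iff[OF bij_betw_imp_inj_on[OF h] cl(1)[OF that(1)] cl(1)[OF that(2)]] .
    finally show ?thesis .
  qed
  have rel: "(x, y) \<in> rel S \<longleftrightarrow> (F x, F y) \<in> rel T" if "x \<in> universe S" "y \<in> universe S" for x y
    using eq_equiv_class_iff[OF eS that] eq[OF that] by (simp add: cl_def)
  have classT: "h C \<subseteq> universe T" if "C \<in> classes S" for C
    using hT[OF that] in_quotient_imp_subset[OF eT] by (simp add: classes_def)
  have "inj_on F (universe S)"
  proof (rule inj_onI)
    fix x y assume xy: "x \<in> universe S" "y \<in> universe S" "F x = F y"
    have "F x \<in> universe T" using F[OF xy(1)] classT cl(1)[OF xy(1)] by blast
    then have "(F x, F y) \<in> rel T" using xy(3) eT by (metis equivE refl_onD)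
    then have "cl x = cl y" using eq[OF xy(1,2)] by simp
    then show "x = y"
      using xy(3) cl(2)[OF xy(1)] cl(2)[OF xy(2)] inj_onD[OF bij_betw_imp_inj_on[OF f[OF cl(1)[OF xy(1)]]]]
      by (simp add: F_def)
  qed
  moreover have "F ` universe S = universe T"
  proof
    show "F ` universe S \<subseteq> universe T" using F classT cl(1) by blast
    show "universe T \<subseteq> F ` universe S"
    proof
      fix y assume y: "y \<in> universe T"
      then have "rel T `` {y} \<in> classes T" by (simp add: classes_def quotientI)
      then obtain C where C: "C \<in> classes S" "h C = rel T `` {y}"
        using h by (metis bij_betw_imp_surj_on imageE)
      have "y \<in> h C" using C(2) equiv_class_self[OF eT y] by simp
      then obtain x where x: "x \<in> C" "f C x = y" using f[OF C(1)] by (metis bij_betw_imp_surj_on imageE)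
      have "x \<in> universe S" using x C(1) in_quotient_imp_subset[OF eS] by (auto simp: classes_def)
      moreover have "F x = y" using x cl_eq[OF C(1) x(1)] by (simp add: F_def)
      ultimately show "y \<in> F ` universe S" by blast
    qed
  qed
  ultimately show ?thesis
    using rel by (auto simp: isomorphic_def bij_betw_def)
qed

section \<open>Uniqueness and difference of the isomorphism types\<close>

lemma infinite_countable_bij:
  assumes "infinite A" "infinite B" "countable A" "countable B"
  shows "\<exists>f. bij_betw f A B"
  using to_nat_on_infinite[OF assms(3,1)] bij_betw_from_nat_into[OF assms(4,2)]
  by (blast intro: bij_betw_trans)

text \<open>Countably infinite sets are equinumerous, so both the infinite classes and the elements
  within one of them can be matched. Only the finite classes have to be counted, and leaving their
  matching as a hypothesis serves one finite class as well as infinitely many.\<close>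

lemma isomorphic_two_sizes:
  fixes S T :: "nat struct"
  assumes S: "equivalence_struct S" and T: "equivalence_struct T"
    and sS: "\<forall>C\<in>classes S. infinite C \<or> finite C \<and> card C = k"
    and sT: "\<forall>C\<in>classes T. infinite C \<or> finite C \<and> card C = k"
    and iS: "infinite {C \<in> classes S. infinite C}" and iT: "infinite {C \<in> classes T. infinite C}"
    and fin: "\<exists>g. bij_betw g {C \<in> classes S. finite C \<and> card C = k} {C \<in> classes T. finite C \<and> card C = k}"
  shows "S \<cong> T"
proof -
  have count: "countable {C \<in> classes V. infinite C}" for V :: "nat struct"
  proof -
    have "classes V = (\<lambda>x. rel V `` {x}) ` universe V" by (auto simp: classes_def quotient_def)
    then have "countable (classes V)" by simp
    then show ?thesis by (rule countable_subset[rotated]) blast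
  qed
  obtain h where h: "bij_betw h {C \<in> classes S. infinite C} {C \<in> classes T. infinite C}"
    using infinite_countable_bij[OF iS iT count count] by blast
  obtain g where g: "bij_betw g {C \<in> classes S. finite C \<and> card C = k} {C \<in> classes T. finite C \<and> card C = k}"
    using fin by blast
  let ?h = "\<lambda>C. if C \<in> {C \<in> classes S. infinite C} then h C else g C"
  have "bij_betw ?h ({C \<in> classes S. infinite C} \<union> {C \<in> classes S. finite C \<and> card C = k})
      ({C \<in> classes T. infinite C} \<union> {C \<in> classes T. finite C \<and> card C = k})"
    by (rule bij_betw_disjoint_Un[OF h g]) auto
  moreover have "{C \<in> classes S. infinite C} \<union> {C \<in> classes S. finite C \<and> card C = k} = classes S"
    "{C \<in> classes T. infinite C} \<union> {C \<in> classes T. finite C \<and> card C = k} = classes T"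
    using sS sT by auto
  ultimately have "bij_betw ?h (classes S) (classes T)" by simp
  moreover have "\<exists>f. bij_betw f C (?h C)" if C: "C \<in> classes S" for C
  proof (cases "infinite C")
    case True
    then have "infinite (h C)" using h C by (auto simp: bij_betw_def)
    with True C show ?thesis using infinite_countable_bij[of C "h C"] by auto
  next
    case False
    then have "C \<in> {C \<in> classes S. finite C \<and> card C = k}" using C sS by blast
    then have "g C \<in> {C \<in> classes T. finite C \<and> card C = k}" using g by (auto simp: bij_betw_def)
    then show ?thesis using False C sS by (auto intro!: finite_same_card_bij)
  qed
  then obtain f where "\<And>C. C \<in> classes S \<Longrightarrow> bij_betw (f C) C (?h C)" by metis
  ultimately show ?thesis by (rule isomorphic_if_bij_classes[OF S T])
qed

lemma E_hat_isomorphic: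
  assumes "S \<in> E_hat k" "T \<in> E_hat k" shows "S \<cong> T"
proof -
  have count: "countable {C \<in> classes V. finite C \<and> card C = k}" for V :: "nat struct"
  proof -
    have "classes V = (\<lambda>x. rel V `` {x}) ` universe V" by (auto simp: classes_def quotient_def)
    then have "countable (classes V)" by simp
    then show ?thesis by (rule countable_subset[rotated]) blast
  qed
  have "infinite {C \<in> classes V. finite C \<and> card C = k}" if "V \<in> E_hat k" for V
    using that by (simp add: E_hat_def)
  from infinite_countable_bij[OF this this count count] assms show ?thesis
    by (intro isomorphic_two_sizes[of S T k]) (auto simp: E_hat_def)
qed

lemma E_isomorphic:
  assumes "S \<in> E k" "T \<in> E k" shows "S \<cong> T"
proof -
  have "\<exists>C. {C \<in> classes V. finite C \<and> card C = k} = {C}" if "V \<in> E k" for V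
    using that by (auto simp: E_def)
  then obtain C D where
    "{C \<in> classes S. finite C \<and> card C = k} = {C}" "{C \<in> classes T. finite C \<and> card C = k} = {D}"
    using assms by meson
  then have "\<exists>g. bij_betw g {C \<in> classes S. finite C \<and> card C = k} {C \<in> classes T. finite C \<and> card C = k}"
    by (intro exI[of _ "\<lambda>_. D"]) simp
  with assms show ?thesis
    by (intro isomorphic_two_sizes[of S T k]) (auto simp: E_def)
qed

text \<open>The invariant that separates size 1 from size 2: an element related to nothing but
  itself.\<close>

lemma isomorphic_singleton_class:
  assumes "S \<cong> T" "x \<in> universe S" "\<forall>y\<in>universe S. (x, y) \<in> rel S \<longrightarrow> y = x"
  shows "\<exists>x\<in>universe T. \<forall>y\<in>universe T. (x, y) \<in> rel T \<longrightarrow> y = x"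
proof -
  obtain f where f: "bij_betw f (universe S) (universe T)"
    "\<forall>x\<in>universe S. \<forall>y\<in>universe S. (x, y) \<in> rel S \<longleftrightarrow> (f x, f y) \<in> rel T"
    using assms(1) by (auto simp: isomorphic_def)
  have T: "universe T = f ` universe S" using f(1) by (simp add: bij_betw_def)
  show ?thesis unfolding T using f(2) assms(2,3) by auto
qed

lemma not_isomorphic_1_2:
  fixes S T :: "nat struct"
  assumes S: "equivalence_struct S" "C \<in> classes S" "card C = 1"
    and T: "equivalence_struct T" "\<forall>C\<in>classes T. infinite C \<or> finite C \<and> card C = 2"
  shows "\<not> S \<cong> T"
proof
  assume iso: "S \<cong> T"
  have eS: "equiv (universe S) (rel S)" and eT: "equiv (universe T) (rel T)"
    using S T by (simp_all add: equivalence_struct_def)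
  obtain x where x: "x \<in> universe S" "C = rel S `` {x}"
    using S(2) by (auto simp: classes_def elim: quotientE)
  obtain z where "C = {z}" using S(3) by (metis card_1_singletonE)
  moreover have "x \<in> C" using x equiv_class_self[OF eS x(1)] by simp
  ultimately have "C = {x}" by simp
  then have "\<forall>y\<in>universe S. (x, y) \<in> rel S \<longrightarrow> y = x" using x(2) by blast
  from isomorphic_singleton_class[OF iso x(1) this] obtain y
    where y: "y \<in> universe T" "\<forall>z\<in>universe T. (y, z) \<in> rel T \<longrightarrow> z = y" by blast
  have "rel T `` {y} = {y}"
    using y equiv_class_self[OF eT y(1)] eT by (auto simp: equiv_def)
  moreover have "rel T `` {y} \<in> classes T" using y(1) by (simp add: classes_def quotientI)
  ultimately show False using T(2) by fastforce
qed

lemma isomorphism_types_E: "isomorphism_types (E 1) (E 2)"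
  unfolding isomorphism_types_def
proof (intro conjI ballI)
  show "is_struct S" if "S \<in> E 1 \<union> E 2" for S using that by (auto simp: E_def equivalence_struct_def)
  show "\<not> S \<cong> T" if "S \<in> E 1" "T \<in> E 2" for S T
  proof -
    have "\<exists>!C. C \<in> classes S \<and> finite C \<and> card C = 1" using that(1) by (simp add: E_def)
    then obtain C where "C \<in> classes S" "card C = 1" by blast
    then show ?thesis using that by (intro not_isomorphic_1_2) (auto simp: E_def)
  qed
qed (auto intro: E_isomorphic)

lemma isomorphism_types_E_hat: "isomorphism_types (E_hat 1) (E_hat 2)"
  unfolding isomorphism_types_def
proof (intro conjI ballI)
  show "is_struct S" if "S \<in> E_hat 1 \<union> E_hat 2" for S
    using that by (auto simp: E_hat_def equivalence_struct_def)
  show "\<not> S \<cong> T" if "S \<in> E_hat 1" "T \<in> E_hat 2" for S T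
  proof -
    have "infinite {C \<in> classes S. finite C \<and> card C = 1}" using that(1) by (simp add: E_hat_def)
    then obtain C where "C \<in> classes S" "card C = 1"
      using not_finite_existsD[of "\<lambda>C. C \<in> classes S \<and> finite C \<and> card C = 1"] by blast
    then show ?thesis using that by (intro not_isomorphic_1_2) (auto simp: E_hat_def)
  qed
qed (auto intro: E_hat_isomorphic)

subsection \<open>Structures given by labelled classes\<close>

text \<open>Elements are coded as pairs of a label and a further entry; two elements are equivalent when
  they have the same label. \<open>members U S l\<close> is a copy of the class with label \<open>l\<close>.\<close>

definition members :: "((nat \<times> nat) set \<Rightarrow> nat \<Rightarrow> bool) \<Rightarrow> nat struct \<Rightarrow> nat \<Rightarrow> nat set" where
  "members U S l = {y. U (rel S) (prod_encode (l, y))}"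

abbreviation same_label :: "nat \<Rightarrow> nat \<Rightarrow> bool" where
  "same_label u v \<equiv> pfst u = pfst v"

lemma labelled_classes:
  defines "c U S l \<equiv> (\<lambda>y. prod_encode (l, y)) ` members U S l"
  assumes "members U S l\<^sub>0 \<noteq> {}"
  shows "equivalence_struct (restriction U same_label S)"
    and "classes (restriction U same_label S) = c U S ` {l. members U S l \<noteq> {}}"
    and "inj_on (c U S) {l. members U S l \<noteq> {}}"
    and "finite (c U S l) \<longleftrightarrow> finite (members U S l)" and "card (c U S l) = card (members U S l)"
proof -
  let ?T = "restriction U same_label S"
  have c: "c U S l = {u. U (rel S) u \<and> pfst u = l}" for l
    by (auto simp: c_def members_def image_iff) (metis prod_decode_inverse prod.collapse)
  have T: "universe ?T = {u. U (rel S) u}" "rel ?T = {(u, v). U (rel S) u \<and> U (rel S) v \<and> pfst u = pfst v}"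
    by (simp_all add: restriction_def)
  have eq: "equiv (universe ?T) (rel ?T)"
    unfolding T by (auto intro!: equivI refl_onI symI transI)
  obtain y where "U (rel S) (prod_encode (l\<^sub>0, y))" using assms(2) by (auto simp: members_def)
  then show "equivalence_struct ?T"
    using eq by (auto simp: equivalence_struct_def is_struct_def T)
  have cl: "rel ?T `` {u} = c U S (pfst u)" if "U (rel S) u" for u
    using that by (auto simp: T c)
  have "members U S (pfst u) \<noteq> {}" if "U (rel S) u" for u
    using that by (auto simp: members_def intro!: exI[of _ "psnd u"])
  moreover have "\<exists>u. U (rel S) u \<and> pfst u = l" if "members U S l \<noteq> {}" for l
  proof -
    obtain y where "U (rel S) (prod_encode (l, y))" using \<open>members U S l \<noteq> {}\<close> by (auto simp: members_def)
    then show ?thesis by (intro exI[of _ "prod_encode (l, y)"]) simp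
  qed
  ultimately have "{l. members U S l \<noteq> {}} = pfst ` {u. U (rel S) u}" by force
  moreover have "classes ?T = (\<lambda>u. c U S (pfst u)) ` {u. U (rel S) u}"
    using cl by (auto simp: classes_def quotient_def T(1))
  ultimately show "classes ?T = c U S ` {l. members U S l \<noteq> {}}" by (simp add: image_image)
  show "inj_on (c U S) {l. members U S l \<noteq> {}}"
  proof (rule inj_onI)
    fix l l' assume l: "l \<in> {l. members U S l \<noteq> {}}" "c U S l = c U S l'"
    then obtain y where "y \<in> members U S l" by blast
    then have "prod_encode (l, y) \<in> c U S l" unfolding c_def by blast
    then have "prod_encode (l, y) \<in> c U S l'" using l(2) by simp
    then show "l = l'" by (simp add: c)
  qed
  have "inj_on (\<lambda>y. prod_encode (l, y)) (members U S l)" by (simp add: inj_on_def)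
  then show "finite (c U S l) \<longleftrightarrow> finite (members U S l)" "card (c U S l) = card (members U S l)"
    by (auto simp: c_def finite_image_iff card_image)
qed

lemma restriction_E:
  assumes k: "k > 0" and i: "infinite {l. infinite (members U S l)}"
    and f: "\<exists>!l. finite (members U S l) \<and> card (members U S l) = k"
    and s: "\<And>l. finite (members U S l) \<Longrightarrow> members U S l \<noteq> {} \<Longrightarrow> card (members U S l) = k"
  shows "restriction U same_label S \<in> E k"
proof -
  let ?T = "restriction U same_label S"
  define c where "c l = (\<lambda>y. prod_encode (l, y)) ` members U S l" for l
  obtain l\<^sub>0 where l0: "finite (members U S l\<^sub>0)" "card (members U S l\<^sub>0) = k"
    and uniq: "\<And>l. finite (members U S l) \<Longrightarrow> card (members U S l) = k \<Longrightarrow> l = l\<^sub>0"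
    using f by blast
  \<comment> \<open>The empty set has cardinality 0, so \<open>k > 0\<close> is what tells a label
    of a genuine class from a label without elements.\<close>
  have ne: "members U S l\<^sub>0 \<noteq> {}" using l0 k by auto
  note cl = labelled_classes[OF ne, folded c_def]
  have "{C \<in> classes ?T. infinite C} = c ` {l. infinite (members U S l)}"
    unfolding cl(2) using cl(4) by auto
  moreover have "inj_on c {l. infinite (members U S l)}"
    by (rule inj_on_subset[OF cl(3)]) auto
  ultimately have "infinite {C \<in> classes ?T. infinite C}" using i by (simp add: finite_image_iff)
  moreover have "\<exists>!C. C \<in> classes ?T \<and> finite C \<and> card C = k"
  proof (rule ex1I[of _ "c l\<^sub>0"])
    show "c l\<^sub>0 \<in> classes ?T \<and> finite (c l\<^sub>0) \<and> card (c l\<^sub>0) = k"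
      using l0 ne cl(2,4,5) by auto
    show "C = c l\<^sub>0" if "C \<in> classes ?T \<and> finite C \<and> card C = k" for C
      using that uniq cl(4,5) unfolding cl(2) by auto
  qed
  moreover have "\<forall>C\<in>classes ?T. infinite C \<or> finite C \<and> card C = k"
    unfolding cl(2) using s cl(4,5) by auto
  ultimately show ?thesis using cl(1) by (simp add: E_def)
qed

lemma restriction_E_hat:
  assumes k: "k > 0" and i: "infinite {l. infinite (members U S l)}"
    and f: "infinite {l. finite (members U S l) \<and> card (members U S l) = k}"
    and s: "\<And>l. finite (members U S l) \<Longrightarrow> members U S l \<noteq> {} \<Longrightarrow> card (members U S l) = k"
  shows "restriction U same_label S \<in> E_hat k"
proof -
  let ?T = "restriction U same_label S"
  define c where "c l = (\<lambda>y. prod_encode (l, y)) ` members U S l" for l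
  obtain l\<^sub>0 where ne: "members U S l\<^sub>0 \<noteq> {}"
    using not_finite_existsD[OF i] by (metis finite.emptyI)
  note cl = labelled_classes[OF ne, folded c_def]
  have "{C \<in> classes ?T. infinite C} = c ` {l. infinite (members U S l)}"
    unfolding cl(2) using cl(4) by auto
  moreover have "inj_on c {l. infinite (members U S l)}"
    by (rule inj_on_subset[OF cl(3)]) auto
  ultimately have "infinite {C \<in> classes ?T. infinite C}" using i by (simp add: finite_image_iff)
  moreover have "{C \<in> classes ?T. finite C \<and> card C = k} = c ` {l. finite (members U S l) \<and> card (members U S l) = k}"
    unfolding cl(2) using cl(4,5) k by auto
  moreover have "inj_on c {l. finite (members U S l) \<and> card (members U S l) = k}"
    by (rule inj_on_subset[OF cl(3)]) (use k in auto)
  ultimately have "infinite {C \<in> classes ?T. infinite C}" "infinite {C \<in> classes ?T. finite C \<and> card C = k}"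
    using f by (simp_all add: finite_image_iff)
  moreover have "\<forall>C\<in>classes ?T. infinite C \<or> finite C \<and> card C = k"
    unfolding cl(2) using s cl(4,5) by auto
  ultimately show ?thesis using cl(1) by (simp add: E_hat_def)
qed

section \<open>Countable dense linear orders\<close>

text \<open>Carrier and relation are explicit because the orders met here live on subsets of
  \<open>nat\<close> and are unrelated to its usual order.\<close>

locale unbounded_dense_order =
  fixes A :: "'a set" and lt :: "'a \<Rightarrow> 'a \<Rightarrow> bool"
  assumes countable: "countable A" and nonempty: "A \<noteq> {}"
    and irrefl: "x \<in> A \<Longrightarrow> \<not> lt x x"
    and trans: "x \<in> A \<Longrightarrow> y \<in> A \<Longrightarrow> z \<in> A \<Longrightarrow> lt x y \<Longrightarrow> lt y z \<Longrightarrow> lt x z"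
    and total: "x \<in> A \<Longrightarrow> y \<in> A \<Longrightarrow> x \<noteq> y \<Longrightarrow> lt x y \<or> lt y x"
    and dense: "x \<in> A \<Longrightarrow> y \<in> A \<Longrightarrow> lt x y \<Longrightarrow> \<exists>z\<in>A. lt x z \<and> lt z y"
    and no_least: "x \<in> A \<Longrightarrow> \<exists>y\<in>A. lt y x"
    and no_greatest: "x \<in> A \<Longrightarrow> \<exists>y\<in>A. lt x y"
begin

lemma converse: "unbounded_dense_order A (\<lambda>x y. lt y x)"
  using countable nonempty irrefl trans total dense no_least no_greatest
  by unfold_locales metis+

lemma asym: "x \<in> A \<Longrightarrow> y \<in> A \<Longrightarrow> lt x y \<Longrightarrow> \<not> lt y x"
  using irrefl[of x] trans[of x y x] by blast

lemma greatest_finite: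
  assumes "finite L" "L \<noteq> {}" "L \<subseteq> A" shows "\<exists>m\<in>L. \<forall>l\<in>L. l = m \<or> lt l m"
  using assms
proof (induction rule: finite_ne_induct)
  case (insert x L)
  then obtain m where m: "m \<in> L" "\<forall>l\<in>L. l = m \<or> lt l m" by auto
  have A: "x \<in> A" "m \<in> A" "L \<subseteq> A" using insert m by auto
  show ?case
  proof (cases "lt m x")
    case True
    then have "\<forall>l\<in>L. lt l x" using m(2) A trans by (metis subsetD)
    then show ?thesis by blast
  next
    case False
    then have "x = m \<or> lt x m" using total[OF A(1,2)] by blast
    then show ?thesis using m by (intro bexI[of _ m]) auto
  qed
qed auto

text \<open>Only the greatest element of \<open>L\<close> and the least of \<open>R\<close> matter,
  the latter being found in the converse order. An empty side is covered by the absence of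
  endpoints.\<close>

lemma between:
  assumes "finite L" "L \<subseteq> A" "finite R" "R \<subseteq> A" "\<And>l r. l \<in> L \<Longrightarrow> r \<in> R \<Longrightarrow> lt l r"
  shows "\<exists>z\<in>A. (\<forall>l\<in>L. lt l z) \<and> (\<forall>r\<in>R. lt z r)"
proof -
  have L: "\<exists>m\<in>L. \<forall>l\<in>L. l = m \<or> lt l m" if "L \<noteq> {}"
    using greatest_finite[OF assms(1) that assms(2)] .
  have R: "\<exists>n\<in>R. \<forall>r\<in>R. r = n \<or> lt n r" if "R \<noteq> {}"
    using unbounded_dense_order.greatest_finite[OF converse assms(3) that assms(4)] .
  have above: "\<forall>l\<in>L. lt l z" if "m \<in> L" "\<forall>l\<in>L. l = m \<or> lt l m" "z \<in> A" "lt m z" for m z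
    using that assms(2) trans by (metis subsetD)
  have below: "\<forall>r\<in>R. lt z r" if "n \<in> R" "\<forall>r\<in>R. r = n \<or> lt n r" "z \<in> A" "lt z n" for n z
    using that assms(4) trans by (metis subsetD)
  show ?thesis
  proof (cases "L = {}")
    case True
    show ?thesis
    proof (cases "R = {}")
      case True
      with \<open>L = {}\<close> nonempty show ?thesis by blast
    next
      case False
      then obtain n where n: "n \<in> R" "\<forall>r\<in>R. r = n \<or> lt n r" using R by blast
      moreover obtain z where "z \<in> A" "lt z n" using no_least n(1) assms(4) by (metis subsetD)
      ultimately show ?thesis using below[OF n] \<open>L = {}\<close> by blast
    qed
  next
    case False
    then obtain m where m: "m \<in> L" "\<forall>l\<in>L. l = m \<or> lt l m" using L by blast
    show ?thesis
    proof (cases "R = {}")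
      case True
      obtain z where "z \<in> A" "lt m z" using no_greatest m(1) assms(2) by (metis subsetD)
      then show ?thesis using above[OF m] True by blast
    next
      case False
      then obtain n where n: "n \<in> R" "\<forall>r\<in>R. r = n \<or> lt n r" using R by blast
      obtain z where "z \<in> A" "lt m z" "lt z n"
        using dense[OF _ _ assms(5)[OF m(1) n(1)]] m(1) n(1) assms(2,4) by (metis subsetD)
      then show ?thesis using above[OF m] below[OF n] by blast
    qed
  qed
qed

end

section \<open>Cantor's theorem by back and forth\<close>

definition partial_order_iso ::
    "'a set \<Rightarrow> ('a \<Rightarrow> 'a \<Rightarrow> bool) \<Rightarrow> 'b set \<Rightarrow> ('b \<Rightarrow> 'b \<Rightarrow> bool) \<Rightarrow> ('a \<times> 'b) set \<Rightarrow> bool" where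
  "partial_order_iso A lt B lt' p \<longleftrightarrow> p \<subseteq> A \<times> B \<and>
     (\<forall>x u y v. (x, u) \<in> p \<longrightarrow> (y, v) \<in> p \<longrightarrow> (lt x y \<longleftrightarrow> lt' u v) \<and> (x = y \<longleftrightarrow> u = v))"

lemma partial_order_iso_converse:
  assumes "partial_order_iso A lt B lt' p" shows "partial_order_iso B lt' A lt (p\<inverse>)"
  unfolding partial_order_iso_def
proof (intro conjI allI impI)
  show "p\<inverse> \<subseteq> B \<times> A" using assms by (auto simp: partial_order_iso_def)
  fix u x v y assume "(u, x) \<in> p\<inverse>" "(v, y) \<in> p\<inverse>"
  then show "lt' u v \<longleftrightarrow> lt x y" "u = v \<longleftrightarrow> x = y"
    using assms unfolding partial_order_iso_def converse_iff by metis+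
qed

text \<open>The new point is sent into the gap between the images of the points below it and of
  those above it. Applied to the converse relation, the same statement is the back step.\<close>

lemma partial_order_iso_extend:
  assumes A: "unbounded_dense_order A lt" and B: "unbounded_dense_order B lt'"
    and p: "partial_order_iso A lt B lt' p" "finite p" and x: "x \<in> A"
  shows "\<exists>q. p \<subseteq> q \<and> finite q \<and> partial_order_iso A lt B lt' q \<and> x \<in> Domain q"
proof (cases "x \<in> Domain p")
  case False
  interpret A: unbounded_dense_order A lt by (rule A)
  interpret B: unbounded_dense_order B lt' by (rule B)
  have pA: "y \<in> A" and pB: "v \<in> B" if "(y, v) \<in> p" for y v
    using that p(1) by (auto simp: partial_order_iso_def)
  have iso: "lt y y' \<longleftrightarrow> lt' v v'" if "(y, v) \<in> p" "(y', v') \<in> p" for y v y' v'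
    using that p(1) unfolding partial_order_iso_def by blast
  define L where "L = {v. \<exists>y. (y, v) \<in> p \<and> lt y x}"
  define R where "R = {v. \<exists>y. (y, v) \<in> p \<and> lt x y}"
  have "finite L" "finite R"
    by (rule finite_subset[OF _ finite_imageI[OF p(2), of snd]]; force simp: L_def R_def)+
  moreover have "L \<subseteq> B" "R \<subseteq> B" using pB by (auto simp: L_def R_def)
  moreover have "lt' l r" if "l \<in> L" "r \<in> R" for l r
  proof -
    obtain y y' where "(y, l) \<in> p" "lt y x" "(y', r) \<in> p" "lt x y'"
      using \<open>l \<in> L\<close> \<open>r \<in> R\<close> by (auto simp: L_def R_def)
    then show ?thesis using iso A.trans[OF pA x pA] by metis
  qed
  ultimately obtain z where z: "z \<in> B" "\<forall>l\<in>L. lt' l z" "\<forall>r\<in>R. lt' z r"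
    using B.between by metis
  have key: "x \<noteq> y \<and> v \<noteq> z \<and> (lt x y \<longleftrightarrow> lt' z v) \<and> (lt y x \<longleftrightarrow> lt' v z)" if yv: "(y, v) \<in> p" for y v
  proof -
    have ne: "x \<noteq> y" using False yv by blast
    consider "lt x y" | "lt y x" using A.total[OF x pA[OF yv] ne] by blast
    then show ?thesis
    proof cases
      case 1
      then have "lt' z v" using z(3) yv by (force simp: R_def)
      then show ?thesis
        using 1 ne A.asym[OF x pA[OF yv]] B.asym[OF z(1) pB[OF yv]] B.irrefl[OF z(1)] by metis
    next
      case 2
      then have "lt' v z" using z(2) yv by (force simp: L_def)
      then show ?thesis
        using 2 ne A.asym[OF pA[OF yv] x] B.asym[OF pB[OF yv] z(1)] B.irrefl[OF z(1)] by metis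
    qed
  qed
  have "partial_order_iso A lt B lt' (insert (x, z) p)"
    unfolding partial_order_iso_def
  proof (intro conjI allI impI)
    show "insert (x, z) p \<subseteq> A \<times> B" using p(1) x z(1) by (auto simp: partial_order_iso_def)
    fix y u y' v assume yu: "(y, u) \<in> insert (x, z) p" "(y', v) \<in> insert (x, z) p"
    show "lt y y' \<longleftrightarrow> lt' u v"
      using yu key[of y u] key[of y' v] iso[of y u y' v] A.irrefl[OF x] B.irrefl[OF z(1)] by blast
    have "y = y' \<longleftrightarrow> u = v" if "(y, u) \<in> p" "(y', v) \<in> p"
      using that p(1) unfolding partial_order_iso_def by blast
    then show "y = y' \<longleftrightarrow> u = v"
      using yu key[of y u] key[of y' v] by blast
  qed
  then show ?thesis using p(2) by (intro exI[of _ "insert (x, z) p"]) auto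
qed (use p in blast)

lemma unbounded_dense_orders_isomorphic:
  assumes A: "unbounded_dense_order A lt" and B: "unbounded_dense_order B lt'"
  shows "\<exists>f. bij_betw f A B \<and> (\<forall>x\<in>A. \<forall>y\<in>A. lt x y \<longleftrightarrow> lt' (f x) (f y))"
proof -
  interpret A: unbounded_dense_order A lt by (rule A)
  interpret B: unbounded_dense_order B lt' by (rule B)
  define iso where "iso p \<longleftrightarrow> finite p \<and> partial_order_iso A lt B lt' p" for p
  let ?a = "from_nat_into A" and ?b = "from_nat_into B"
  \<comment> \<open>Stage \<open>n\<close> takes care of the \<open>n\<close>-th element of both
    enumerations, so the union of the stages is total and onto.\<close>
  have "\<exists>P. \<forall>n. iso (P n) \<and> (P n \<subseteq> P (Suc n) \<and> ?a n \<in> Domain (P (Suc n)) \<and> ?b n \<in> Range (P (Suc n)))"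
  proof (rule dependent_nat_choice)
    show "\<exists>p. iso p" by (auto simp: iso_def partial_order_iso_def)
  next
    fix p n assume "iso p"
    then obtain q where q: "p \<subseteq> q" "finite q" "partial_order_iso A lt B lt' q" "?a n \<in> Domain q"
      using partial_order_iso_extend[OF A B] from_nat_into[OF A.nonempty] unfolding iso_def by metis
    obtain q' where q': "q\<inverse> \<subseteq> q'" "finite q'" "partial_order_iso B lt' A lt q'" "?b n \<in> Domain q'"
      using partial_order_iso_extend[OF B A partial_order_iso_converse[OF q(3)]]
        from_nat_into[OF B.nonempty] q(2) by (metis finite_converse)
    have "iso (q'\<inverse>)" using q'(2,3) by (simp add: iso_def partial_order_iso_converse)
    moreover have "p \<subseteq> q'\<inverse>" "?a n \<in> Domain (q'\<inverse>)" "?b n \<in> Range (q'\<inverse>)" using q(1,4) q'(1,4) by auto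
    ultimately show "\<exists>q. iso q \<and> p \<subseteq> q \<and> ?a n \<in> Domain q \<and> ?b n \<in> Range q" by blast
  qed
  then obtain P where P: "\<And>n. iso (P n)" "\<And>n. P n \<subseteq> P (Suc n)"
    "\<And>n. ?a n \<in> Domain (P (Suc n))" "\<And>n. ?b n \<in> Range (P (Suc n))" by blast
  have mono: "m \<le> n \<Longrightarrow> P m \<subseteq> P n" for m n by (rule lift_Suc_mono_le) (use P(2) in auto)
  define G where "G = (\<Union>n. P n)"
  have G: "x \<in> A \<and> u \<in> B \<and> y \<in> A \<and> v \<in> B \<and> (lt x y \<longleftrightarrow> lt' u v) \<and> (x = y \<longleftrightarrow> u = v)"
    if xu: "(x, u) \<in> G" and yv: "(y, v) \<in> G" for x u y v
  proof -
    obtain m n where "(x, u) \<in> P m" "(y, v) \<in> P n" using xu yv by (auto simp: G_def)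
    then have "(x, u) \<in> P (max m n)" "(y, v) \<in> P (max m n)"
      using mono[of m "max m n"] mono[of n "max m n"] by auto
    then show ?thesis using P(1)[of "max m n"] by (fastforce simp: iso_def partial_order_iso_def)
  qed
  have dom: "\<exists>u. (x, u) \<in> G" if "x \<in> A" for x
    using P(3)[of "to_nat_on A x"] that A.countable by (auto simp: G_def)
  have ran: "\<exists>x. (x, u) \<in> G" if "u \<in> B" for u
    using P(4)[of "to_nat_on B u"] that B.countable by (auto simp: G_def)
  obtain f where f: "\<And>x. x \<in> A \<Longrightarrow> (x, f x) \<in> G" using dom by metis
  have "inj_on f A" using f G by (metis inj_onI)
  moreover have "f ` A = B"
  proof
    show "f ` A \<subseteq> B" using f G by blast
    show "B \<subseteq> f ` A"
    proof
      fix u assume "u \<in> B"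
      then obtain x where x: "(x, u) \<in> G" using ran by blast
      then have "x \<in> A" using G by blast
      then show "u \<in> f ` A" using G[OF x f] by blast
    qed
  qed
  moreover have "\<forall>x\<in>A. \<forall>y\<in>A. lt x y \<longleftrightarrow> lt' (f x) (f y)" using f G by blast
  ultimately show ?thesis by (auto simp: bij_betw_def)
qed

lemma unbounded_dense_order_rat: "unbounded_dense_order (UNIV :: rat set) (<)"
proof
  show "\<exists>z\<in>UNIV. x < z \<and> z < y" if "x < y" for x y :: rat using dense[OF that] by blast
  show "\<exists>y\<in>UNIV. y < x" "\<exists>y\<in>UNIV. x < y" for x :: rat using lt_ex gt_ex by blast+
qed auto

section \<open>Dense orders with one endpoint\<close>

definition dense_linear :: "'a struct \<Rightarrow> bool" where
  "dense_linear S \<longleftrightarrow> is_struct S \<and> refl_on (universe S) (rel S) \<and> antisym (rel S) \<and> trans (rel S) \<and>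
     total_on (universe S) (rel S) \<and>
     (\<forall>x\<in>universe S. \<forall>y\<in>universe S. (x, y) \<in> rel S \<and> x \<noteq> y \<longrightarrow>
       (\<exists>z\<in>universe S. (x, z) \<in> rel S \<and> (z, y) \<in> rel S \<and> z \<noteq> x \<and> z \<noteq> y))"

text \<open>The case \<open>flip\<close> turns the order around, so that a least element and a greatest element are
  treated by one argument.\<close>

lemma dense_linear_iso_rat:
  fixes S :: "nat struct"
  assumes S: "dense_linear S" and m: "m \<in> universe S"
    and le: "le = (if flip then (\<lambda>x y. (y, x) \<in> rel S) else (\<lambda>x y. (x, y) \<in> rel S))"
    and least: "\<And>x. x \<in> universe S \<Longrightarrow> le m x"
    and no_greatest: "\<And>x. x \<in> universe S \<Longrightarrow> \<exists>y\<in>universe S. le x y \<and> x \<noteq> y"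
  shows "\<exists>f. bij_betw f (universe S - {m}) (UNIV :: rat set) \<and>
    (\<forall>x\<in>universe S - {m}. \<forall>y\<in>universe S - {m}. (x, y) \<in> rel S \<longleftrightarrow> f x \<le> f y)"
proof -
  let ?A = "universe S - {m}"
  let ?lt = "\<lambda>x y. (x, y) \<in> rel S \<and> x \<noteq> y"
  have refl: "\<And>x. x \<in> universe S \<Longrightarrow> (x, x) \<in> rel S"
    and antisym: "\<And>x y. (x, y) \<in> rel S \<Longrightarrow> (y, x) \<in> rel S \<Longrightarrow> x = y"
    and trans: "\<And>x y z. (x, y) \<in> rel S \<Longrightarrow> (y, z) \<in> rel S \<Longrightarrow> (x, z) \<in> rel S"
    and total: "\<And>x y. x \<in> universe S \<Longrightarrow> y \<in> universe S \<Longrightarrow> x \<noteq> y \<Longrightarrow> (x, y) \<in> rel S \<or> (y, x) \<in> rel S"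
    and dense: "\<And>x y. x \<in> universe S \<Longrightarrow> y \<in> universe S \<Longrightarrow> (x, y) \<in> rel S \<Longrightarrow> x \<noteq> y \<Longrightarrow>
       \<exists>z\<in>universe S. (x, z) \<in> rel S \<and> (z, y) \<in> rel S \<and> z \<noteq> x \<and> z \<noteq> y"
    using S unfolding dense_linear_def refl_on_def antisym_def trans_def total_on_def by blast+
  \<comment> \<open>Removing the endpoint \<open>m\<close> leaves no new one: density supplies a
    point strictly between \<open>m\<close> and \<open>x\<close>.\<close>
  have lower: "\<exists>y\<in>?A. le y x \<and> x \<noteq> y" if "x \<in> ?A" for x
  proof (cases flip)
    case True
    then show ?thesis using dense[of x m] least[of x] that m by (auto simp: le)
  next
    case False
    then show ?thesis using dense[of m x] least[of x] that m by (auto simp: le)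
  qed
  have upper: "\<exists>y\<in>?A. le x y \<and> x \<noteq> y" if "x \<in> universe S" for x
    using no_greatest[OF that] least[OF that] antisym by (auto simp: le split: if_splits)
  have "unbounded_dense_order ?A ?lt"
  proof
    show "?A \<noteq> {}" using upper[OF m] by blast
    show "\<exists>z\<in>?A. ?lt x z \<and> ?lt z y" if "x \<in> ?A" "y \<in> ?A" "?lt x y" for x y
    proof -
      obtain z where z: "z \<in> universe S" "(x, z) \<in> rel S" "(z, y) \<in> rel S" "z \<noteq> x" "z \<noteq> y"
        using dense[of x y] \<open>x \<in> ?A\<close> \<open>y \<in> ?A\<close> \<open>?lt x y\<close> by auto
      have "z \<noteq> m"
        using z \<open>x \<in> ?A\<close> \<open>y \<in> ?A\<close> least[of x] least[of y] antisym
        by (cases flip) (auto simp: le)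
      then show ?thesis using z by blast
    qed
    show "\<exists>y\<in>?A. ?lt y x" if "x \<in> ?A" for x
      using lower[OF that] upper[of x] that by (cases flip) (auto simp: le)
    show "\<exists>y\<in>?A. ?lt x y" if "x \<in> ?A" for x
      using lower[OF that] upper[of x] that by (cases flip) (auto simp: le)
    show "?lt x z" if "?lt x y" "?lt y z" for x y z using that trans antisym by blast
    show "?lt x y \<or> ?lt y x" if "x \<in> ?A" "y \<in> ?A" "x \<noteq> y" for x y using that total by blast
  qed simp_all
  then obtain f where f: "bij_betw f ?A (UNIV :: rat set)"
    "\<forall>x\<in>?A. \<forall>y\<in>?A. ?lt x y \<longleftrightarrow> f x < f y"
    using unbounded_dense_orders_isomorphic[OF _ unbounded_dense_order_rat] by blast
  have "(x, y) \<in> rel S \<longleftrightarrow> f x \<le> f y" if "x \<in> ?A" "y \<in> ?A" for x y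
  proof (cases "x = y")
    case True
    then show ?thesis using refl that by simp
  next
    case False
    then have "f x \<noteq> f y" using f(1) that by (auto simp: bij_betw_def inj_on_def)
    then show ?thesis using False f(2) that by (auto simp: order_le_less)
  qed
  then show ?thesis using f(1) by blast
qed

lemma one_plus_etaI:
  assumes S: "dense_linear S" and m: "m \<in> universe S"
    and least: "\<And>x. x \<in> universe S \<Longrightarrow> (m, x) \<in> rel S"
    and no_greatest: "\<And>x. x \<in> universe S \<Longrightarrow> \<exists>y\<in>universe S. (x, y) \<in> rel S \<and> x \<noteq> y"
  shows "S \<in> one_plus_eta"
proof -
  obtain f where f: "bij_betw f (universe S - {m}) (UNIV :: rat set)"
    "\<forall>x\<in>universe S - {m}. \<forall>y\<in>universe S - {m}. (x, y) \<in> rel S \<longleftrightarrow> f x \<le> f y"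
    using dense_linear_iso_rat[OF S m, where flip = False, OF refl] least no_greatest by auto
  let ?g = "\<lambda>x. if x = m then Inl () else Inr (f x)"
  have "bij_betw ?g (universe S) (universe (order_sum order_one order_eta))"
    using f(1) m by (fastforce simp: bij_betw_def inj_on_def order_sum_def order_one_def order_eta_def image_iff)
  moreover have "x = m" if "(x, m) \<in> rel S" for x
    using S that least[of x] by (auto simp: dense_linear_def is_struct_def antisym_def)
  then have "\<forall>x\<in>universe S. \<forall>y\<in>universe S.
      (x, y) \<in> rel S \<longleftrightarrow> (?g x, ?g y) \<in> rel (order_sum order_one order_eta)"
    using f(2) least by (auto simp: order_sum_def order_one_def order_eta_def)
  ultimately show ?thesis
    using S unfolding one_plus_eta_def copies_def isomorphic_def dense_linear_def by blast
qed

lemma eta_plus_oneI: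
  assumes S: "dense_linear S" and m: "m \<in> universe S"
    and greatest: "\<And>x. x \<in> universe S \<Longrightarrow> (x, m) \<in> rel S"
    and no_least: "\<And>x. x \<in> universe S \<Longrightarrow> \<exists>y\<in>universe S. (y, x) \<in> rel S \<and> x \<noteq> y"
  shows "S \<in> eta_plus_one"
proof -
  obtain f where f: "bij_betw f (universe S - {m}) (UNIV :: rat set)"
    "\<forall>x\<in>universe S - {m}. \<forall>y\<in>universe S - {m}. (x, y) \<in> rel S \<longleftrightarrow> f x \<le> f y"
    using dense_linear_iso_rat[OF S m, where flip = True, OF refl] greatest no_least by auto
  let ?g = "\<lambda>x. if x = m then Inr () else Inl (f x)"
  have "bij_betw ?g (universe S) (universe (order_sum order_eta order_one))"
    using f(1) m by (fastforce simp: bij_betw_def inj_on_def order_sum_def order_one_def order_eta_def image_iff)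
  moreover have "x = m" if "(m, x) \<in> rel S" for x
    using S that greatest[of x] by (auto simp: dense_linear_def is_struct_def antisym_def)
  then have "\<forall>x\<in>universe S. \<forall>y\<in>universe S.
      (x, y) \<in> rel S \<longleftrightarrow> (?g x, ?g y) \<in> rel (order_sum order_eta order_one)"
    using f(2) greatest by (auto simp: order_sum_def order_one_def order_eta_def)
  ultimately show ?thesis
    using S unfolding eta_plus_one_def copies_def isomorphic_def dense_linear_def by blast
qed

section \<open>The input structures\<close>

text \<open>What \<open>E k\<close> and \<open>E_hat k\<close> have in common; the constructions
  produce the required number of output classes themselves.\<close>

locale two_class_sizes =
  fixes S :: "nat struct" and k :: nat
  assumes equivalence: "equivalence_struct S"
    and k: "0 < k" "k \<le> 2"
    and infinite_class: "\<exists>x\<in>universe S. infinite (rel S `` {x})"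
    and finite_class: "\<exists>x\<in>universe S. finite (rel S `` {x})"
    and class_size: "x \<in> universe S \<Longrightarrow> finite (rel S `` {x}) \<Longrightarrow> card (rel S `` {x}) = k"
begin

lemma refl_iff: "(x, x) \<in> rel S \<longleftrightarrow> x \<in> universe S"
  using equivalence by (auto simp: equivalence_struct_def equiv_def refl_on_def is_struct_def)

text \<open>A single infinite class is enough, since all of its own elements qualify. They later
  serve as infinitely many labels.\<close>

lemma infinite_infinite_class: "infinite {x. (x, x) \<in> rel S \<and> infinite (rel S `` {x})}"
proof -
  obtain x where x: "x \<in> universe S" "infinite (rel S `` {x})" using infinite_class by blast
  have eq: "equiv (universe S) (rel S)" using equivalence by (simp add: equivalence_struct_def)
  have "rel S `` {x} \<subseteq> {x. (x, x) \<in> rel S \<and> infinite (rel S `` {x})}"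
  proof
    fix y assume "y \<in> rel S `` {x}"
    then have "rel S `` {y} = rel S `` {x}" "y \<in> universe S"
      using eq x(1) equiv_class_eq_iff by fastforce+
    then show "y \<in> {x. (x, x) \<in> rel S \<and> infinite (rel S `` {x})}" using x refl_iff by simp
  qed
  then show ?thesis using x(2) infinite_super by blast
qed

lemma empty_class_iff: "rel S `` {x} = {} \<longleftrightarrow> x \<notin> universe S"
  using equivalence refl_iff by (auto simp: equivalence_struct_def is_struct_def)

end

lemma two_class_sizesI:
  assumes k: "0 < k" "k \<le> 2" and S: "S \<in> E k \<or> S \<in> E_hat k"
  shows "two_class_sizes S k"
proof
  have S': "equivalence_struct S" "\<exists>C\<in>classes S. infinite C" "\<exists>C\<in>classes S. finite C"
    "\<forall>C\<in>classes S. infinite C \<or> finite C \<and> card C = k"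
  proof -
    show "equivalence_struct S" using S by (auto simp: E_def E_hat_def)
    have "infinite {C \<in> classes S. infinite C}" using S by (auto simp: E_def E_hat_def)
    then show "\<exists>C\<in>classes S. infinite C"
      using not_finite_existsD[of "\<lambda>C. C \<in> classes S \<and> infinite C"] by blast
    show "\<forall>C\<in>classes S. infinite C \<or> finite C \<and> card C = k" using S by (auto simp: E_def E_hat_def)
    show "\<exists>C\<in>classes S. finite C"
    proof (cases "S \<in> E k")
      case True
      then have "\<exists>!C. C \<in> classes S \<and> finite C \<and> card C = k" by (simp add: E_def)
      then show ?thesis by blast
    next
      case False
      then have "infinite {C \<in> classes S. finite C \<and> card C = k}" using S by (simp add: E_hat_def)
      then show ?thesis
        using not_finite_existsD[of "\<lambda>C. C \<in> classes S \<and> finite C \<and> card C = k"] by blast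
    qed
  qed
  show "equivalence_struct S" "0 < k" "k \<le> 2" by fact+
  show "\<exists>x\<in>universe S. infinite (rel S `` {x})" "\<exists>x\<in>universe S. finite (rel S `` {x})"
    using S'(2,3) by (auto simp: classes_def quotient_def)
  show "card (rel S `` {x}) = k" if "x \<in> universe S" "finite (rel S `` {x})" for x
    using S'(4) that by (auto simp: classes_def quotient_def)
qed

text \<open>For \<open>j \<le> 2\<close>, \<open>big r j x\<close> says that the class of \<open>x\<close> has more than \<open>j\<close> elements. As all finite
  classes have size at most 2, \<open>big r 2 x\<close> is positive information that the class of \<open>x\<close> is infinite.\<close>

definition big :: "(nat \<times> nat) set \<Rightarrow> nat \<Rightarrow> nat \<Rightarrow> bool" where
  "big r j x \<longleftrightarrow> (x, x) \<in> r \<and> (1 \<le> j \<longrightarrow> (\<exists>y. (x, y) \<in> r \<and> \<not> y = x)) \<and>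
     (2 \<le> j \<longrightarrow> (\<exists>y. (x, y) \<in> r \<and> (\<exists>z. (x, z) \<in> r \<and> \<not> y = x \<and> \<not> z = x \<and> \<not> z = y)))"

lemma finitary_big [finitary_intros]: "finitary (\<lambda>r. big r j x)"
  unfolding big_def by (intro finitary_intros)

lemma decidable_big [computable_intros]:
  assumes "computable S" "computable J" "computable X"
  shows "decidable (\<lambda>e. big (decode_rel (S e)) (J e) (X e))"
proof -
  have "decidable (\<lambda>e. big (decode_rel (pfst e)) (pfst (psnd e)) (psnd (psnd e)))"
    unfolding big_def by (intro computable_intros)
  from decidable_comp[OF this computable_prod_encode[OF assms(1) computable_prod_encode[OF assms(2,3)]]]
  show ?thesis by simp
qed

text \<open>A finite class has exactly \<open>k\<close> elements, so it has more than
  \<open>j\<close> of them just when \<open>j < k\<close>. For \<open>j = 2\<close> this fails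
  because \<open>k \<le> 2\<close>, and only infinite classes remain.\<close>

lemma (in two_class_sizes) big_iff:
  assumes "j \<le> 2"
  shows "big (rel S) j x \<longleftrightarrow> x \<in> universe S \<and> (finite (rel S `` {x}) \<longrightarrow> j < k)"
proof (cases "x \<in> universe S")
  case True
  let ?C = "rel S `` {x}"
  have x: "x \<in> ?C" using True refl_iff by simp
  have one: "(\<exists>y. (x, y) \<in> rel S \<and> \<not> y = x) \<longleftrightarrow> (finite ?C \<longrightarrow> 1 < card ?C)"
  proof (cases "?C = {x}")
    case False
    then obtain y where y: "y \<in> ?C" "y \<noteq> x" using x by blast
    have "1 < card ?C" if "finite ?C"
      using card_mono[of ?C "{x, y}"] that x y by simp
    then show ?thesis using y by blast
  next
    case True
    then have "\<forall>y. (x, y) \<in> rel S \<longrightarrow> y = x" by blast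
    then show ?thesis using True by simp
  qed
  have two: "(\<exists>y. (x, y) \<in> rel S \<and> (\<exists>z. (x, z) \<in> rel S \<and> \<not> y = x \<and> \<not> z = x \<and> \<not> z = y)) \<longleftrightarrow>
      (finite ?C \<longrightarrow> 2 < card ?C)" (is "?L \<longleftrightarrow> _")
  proof (cases ?L)
    case True
    then obtain y z where yz: "y \<in> ?C" "z \<in> ?C" "y \<noteq> x" "z \<noteq> x" "z \<noteq> y" by blast
    have "2 < card ?C" if "finite ?C"
      using card_mono[of ?C "{x, y, z}"] that x yz by simp
    then show ?thesis using True by blast
  next
    case False
    have "\<exists>y. ?C \<subseteq> {x, y}"
    proof (cases "?C = {x}")
      case neq: False
      then obtain y where "y \<in> ?C" "y \<noteq> x" using x by blast
      then have "?C \<subseteq> {x, y}" using False by blast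
      then show ?thesis ..
    qed auto
    then obtain y where y: "?C \<subseteq> {x, y}" ..
    have "finite ?C" using y finite_subset by fastforce
    moreover have "card ?C \<le> 2" using card_mono[OF _ y] card_insert_le_m1[of 2 "{y}" x] by simp
    ultimately show ?thesis using False by simp
  qed
  have "big (rel S) j x \<longleftrightarrow> (finite ?C \<longrightarrow> j < card ?C)"
  proof -
    consider "j = 0" | "j = 1" | "j = 2" using assms by linarith
    then show ?thesis
    proof cases
      case 1
      then show ?thesis using x True refl_iff by (auto simp: big_def card_gt_0_iff)
    next
      case 2
      then show ?thesis using one True refl_iff by (simp add: big_def)
    next
      case 3
      then show ?thesis using one two True refl_iff by (auto simp: big_def)
    qed
  qed
  then show ?thesis using True class_size[OF True] by auto
qed (use refl_iff in \<open>auto simp: big_def\<close>)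

section \<open>Cuts in the two orders\<close>

lemma finite_card_bij_preimage:
  assumes f: "bij_betw f A B" and x: "x \<in> A" and r: "\<And>y. (y, x) \<in> r \<Longrightarrow> y \<in> A"
    and s: "\<And>y. (y, f x) \<in> s \<Longrightarrow> y \<in> B" and rs: "\<And>y. y \<in> A \<Longrightarrow> (y, x) \<in> r \<longleftrightarrow> (f y, f x) \<in> s"
  shows "finite {y. (y, x) \<in> r} \<longleftrightarrow> finite {z. (z, f x) \<in> s}"
    and "card {y. (y, x) \<in> r} = card {z. (z, f x) \<in> s}"
proof -
  have "f ` {y. (y, x) \<in> r} = {z. (z, f x) \<in> s}"
  proof (intro equalityI subsetI)
    fix z assume "z \<in> {z. (z, f x) \<in> s}"
    then obtain y where "y \<in> A" "z = f y" using s f by (auto simp: bij_betw_def)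
    then show "z \<in> f ` {y. (y, x) \<in> r}" using rs \<open>z \<in> _\<close> by auto
  qed (use r rs in auto)
  moreover have "inj_on f {y. (y, x) \<in> r}"
    using f r by (auto simp: bij_betw_def intro: inj_on_subset)
  ultimately show "finite {y. (y, x) \<in> r} \<longleftrightarrow> finite {z. (z, f x) \<in> s}"
    "card {y. (y, x) \<in> r} = card {z. (z, f x) \<in> s}"
    by (metis finite_image_iff, metis card_image)
qed

text \<open>The reduction to equivalence structures uses an order only through the sizes of its
  cuts, which are computed in the explicit sum and carried over to all copies. Upper cuts are lower
  cuts of the converse relation.\<close>

lemma isomorphic_cut_sizes:
  fixes S :: "nat struct" and M :: "'b struct"
  assumes S: "S \<in> copies M" and M: "rel M \<subseteq> universe M \<times> universe M"
  obtains f where "bij_betw f (universe S) (universe M)"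
    "\<And>x. x \<in> universe S \<Longrightarrow> finite {y. (y, x) \<in> rel S} \<longleftrightarrow> finite {z. (z, f x) \<in> rel M}"
    "\<And>x. x \<in> universe S \<Longrightarrow> card {y. (y, x) \<in> rel S} = card {z. (z, f x) \<in> rel M}"
    "\<And>x. x \<in> universe S \<Longrightarrow> finite {y. (x, y) \<in> rel S} \<longleftrightarrow> finite {z. (f x, z) \<in> rel M}"
    "\<And>x. x \<in> universe S \<Longrightarrow> card {y. (x, y) \<in> rel S} = card {z. (f x, z) \<in> rel M}"
proof -
  obtain f where f: "bij_betw f (universe S) (universe M)"
    "\<forall>x\<in>universe S. \<forall>y\<in>universe S. (x, y) \<in> rel S \<longleftrightarrow> (f x, f y) \<in> rel M"
    using S by (auto simp: copies_def isomorphic_def)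
  have rel: "(x, y) \<in> rel S \<Longrightarrow> x \<in> universe S \<and> y \<in> universe S" for x y
    using S by (auto simp: copies_def is_struct_def)
  show ?thesis
  proof (rule that[OF f(1)])
    fix x assume x: "x \<in> universe S"
    show "finite {y. (y, x) \<in> rel S} \<longleftrightarrow> finite {z. (z, f x) \<in> rel M}"
      "card {y. (y, x) \<in> rel S} = card {z. (z, f x) \<in> rel M}"
      by (rule finite_card_bij_preimage[OF f(1) x]; use rel M f(2) x in blast)+
    have "finite {y. (y, x) \<in> (rel S)\<inverse>} \<longleftrightarrow> finite {z. (z, f x) \<in> (rel M)\<inverse>}"
      "card {y. (y, x) \<in> (rel S)\<inverse>} = card {z. (z, f x) \<in> (rel M)\<inverse>}"
      by (rule finite_card_bij_preimage[OF f(1) x]; use rel M f(2) x in blast)+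
    then show "finite {y. (x, y) \<in> rel S} \<longleftrightarrow> finite {z. (f x, z) \<in> rel M}"
      "card {y. (x, y) \<in> rel S} = card {z. (f x, z) \<in> rel M}" by simp_all
  qed
qed

lemma one_plus_eta_cuts:
  assumes S: "S \<in> one_plus_eta"
  shows "\<exists>m\<in>universe S. finite {y. (y, m) \<in> rel S} \<and> card {y. (y, m) \<in> rel S} = 1 \<and>
      (\<forall>x\<in>universe S. x \<noteq> m \<longrightarrow> infinite {y. (y, x) \<in> rel S})"
    and "\<And>x. x \<in> universe S \<Longrightarrow> infinite {y. (x, y) \<in> rel S}"
proof -
  let ?M = "order_sum order_one order_eta"
  have M: "rel ?M \<subseteq> universe ?M \<times> universe ?M" "Inl () \<in> universe ?M"
    by (auto simp: order_sum_def order_one_def order_eta_def)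
  obtain f where f: "bij_betw f (universe S) (universe ?M)"
    "\<And>x. x \<in> universe S \<Longrightarrow> finite {y. (y, x) \<in> rel S} \<longleftrightarrow> finite {z. (z, f x) \<in> rel ?M}"
    "\<And>x. x \<in> universe S \<Longrightarrow> card {y. (y, x) \<in> rel S} = card {z. (z, f x) \<in> rel ?M}"
    "\<And>x. x \<in> universe S \<Longrightarrow> finite {y. (x, y) \<in> rel S} \<longleftrightarrow> finite {z. (f x, z) \<in> rel ?M}"
    using isomorphic_cut_sizes[OF S[unfolded one_plus_eta_def] M(1)] by metis
  have least: "{z. (z, Inl ()) \<in> rel ?M} = {Inl ()}"
    by (auto simp: order_sum_def order_one_def)
  have down: "infinite {z. (z, Inr q) \<in> rel ?M}" for q
  proof -
    have "Inr ` {..q} \<subseteq> {z. (z, Inr q) \<in> rel ?M}" by (auto simp: order_sum_def order_eta_def)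
    moreover have "infinite (Inr ` {..q} :: (unit + rat) set)" by (simp add: finite_image_iff infinite_Iic)
    ultimately show ?thesis using finite_subset by blast
  qed
  have up: "infinite {z. (u, z) \<in> rel ?M}" for u
  proof -
    \<comment> \<open>Above the endpoint lie all rationals, so the value 0 in the case
      \<open>Inl\<close> is an arbitrary starting point.\<close>
    have "Inr ` {(case u of Inl _ \<Rightarrow> 0 | Inr q \<Rightarrow> q)..} \<subseteq> {z. (u, z) \<in> rel ?M}"
      by (cases u) (auto simp: order_sum_def order_eta_def order_one_def)
    moreover have "infinite (Inr ` {(q :: rat)..} :: (unit + rat) set)" for q
      by (simp add: finite_image_iff infinite_Ici)
    ultimately show ?thesis using finite_subset by blast
  qed
  obtain m where m: "m \<in> universe S" "f m = Inl ()"
    using f(1) M(2) by (metis bij_betw_imp_surj_on imageE)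
  have "\<exists>q. f x = Inr q" if "x \<in> universe S" "x \<noteq> m" for x
  proof (cases "f x")
    case (Inl u)
    then show ?thesis using that m f(1) by (auto simp: bij_betw_def inj_on_def)
  qed auto
  then show "\<exists>m\<in>universe S. finite {y. (y, m) \<in> rel S} \<and> card {y. (y, m) \<in> rel S} = 1 \<and>
      (\<forall>x\<in>universe S. x \<noteq> m \<longrightarrow> infinite {y. (y, x) \<in> rel S})"
    using m f(2)[of m] f(3)[of m] f(2) least down by (intro bexI[of _ m]) (simp_all, metis)
  show "infinite {y. (x, y) \<in> rel S}" if "x \<in> universe S" for x
    using f(4)[OF that] up by simp
qed

lemma eta_plus_one_cuts:
  assumes S: "S \<in> eta_plus_one"
  shows "\<exists>m\<in>universe S. finite {y. (m, y) \<in> rel S} \<and> card {y. (m, y) \<in> rel S} = 1 \<and>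
      (\<forall>x\<in>universe S. x \<noteq> m \<longrightarrow> infinite {y. (x, y) \<in> rel S})"
    and "\<And>x. x \<in> universe S \<Longrightarrow> infinite {y. (y, x) \<in> rel S}"
proof -
  let ?M = "order_sum order_eta order_one"
  have M: "rel ?M \<subseteq> universe ?M \<times> universe ?M" "Inr () \<in> universe ?M"
    by (auto simp: order_sum_def order_one_def order_eta_def)
  obtain f where f: "bij_betw f (universe S) (universe ?M)"
    "\<And>x. x \<in> universe S \<Longrightarrow> finite {y. (y, x) \<in> rel S} \<longleftrightarrow> finite {z. (z, f x) \<in> rel ?M}"
    "\<And>x. x \<in> universe S \<Longrightarrow> finite {y. (x, y) \<in> rel S} \<longleftrightarrow> finite {z. (f x, z) \<in> rel ?M}"
    "\<And>x. x \<in> universe S \<Longrightarrow> card {y. (x, y) \<in> rel S} = card {z. (f x, z) \<in> rel ?M}"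
    using isomorphic_cut_sizes[OF S[unfolded eta_plus_one_def] M(1)] by metis
  have greatest: "{z. (Inr (), z) \<in> rel ?M} = {Inr ()}"
    by (auto simp: order_sum_def order_one_def)
  have up: "infinite {z. (Inl q, z) \<in> rel ?M}" for q
  proof -
    have "Inl ` {q..} \<subseteq> {z. (Inl q, z) \<in> rel ?M}" by (auto simp: order_sum_def order_eta_def)
    moreover have "infinite (Inl ` {q..} :: (rat + unit) set)" by (simp add: finite_image_iff infinite_Ici)
    ultimately show ?thesis using finite_subset by blast
  qed
  have down: "infinite {z. (z, u) \<in> rel ?M}" for u
  proof -
    have "Inl ` {..(case u of Inr _ \<Rightarrow> 0 | Inl q \<Rightarrow> q)} \<subseteq> {z. (z, u) \<in> rel ?M}"
      by (cases u) (auto simp: order_sum_def order_eta_def order_one_def)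
    moreover have "infinite (Inl ` {..(q :: rat)} :: (rat + unit) set)" for q
      by (simp add: finite_image_iff infinite_Iic)
    ultimately show ?thesis using finite_subset by blast
  qed
  obtain m where m: "m \<in> universe S" "f m = Inr ()"
    using f(1) M(2) by (metis bij_betw_imp_surj_on imageE)
  have "\<exists>q. f x = Inl q" if "x \<in> universe S" "x \<noteq> m" for x
  proof (cases "f x")
    case (Inr u)
    then show ?thesis using that m f(1) by (auto simp: bij_betw_def inj_on_def)
  qed auto
  then show "\<exists>m\<in>universe S. finite {y. (m, y) \<in> rel S} \<and> card {y. (m, y) \<in> rel S} = 1 \<and>
      (\<forall>x\<in>universe S. x \<noteq> m \<longrightarrow> infinite {y. (x, y) \<in> rel S})"
    using m f(3)[of m] f(4)[of m] f(3) greatest up by (intro bexI[of _ m]) (simp_all, metis)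
  show "infinite {y. (y, x) \<in> rel S}" if "x \<in> universe S" for x
    using f(2)[OF that] down by simp
qed

lemma isomorphism_types_orders: "isomorphism_types one_plus_eta eta_plus_one"
  unfolding isomorphism_types_def
proof (intro conjI ballI)
  show "is_struct S" if "S \<in> one_plus_eta \<union> eta_plus_one" for S
    using that by (auto simp: one_plus_eta_def eta_plus_one_def copies_def)
  show "S \<cong> T" if "S \<in> one_plus_eta" "T \<in> one_plus_eta" for S T
    using isomorphic_trans[OF _ isomorphic_sym] that unfolding one_plus_eta_def copies_def by blast
  show "S \<cong> T" if "S \<in> eta_plus_one" "T \<in> eta_plus_one" for S T
    using isomorphic_trans[OF _ isomorphic_sym] that unfolding eta_plus_one_def copies_def by blast
  show "\<not> S \<cong> T" if S: "S \<in> one_plus_eta" and T: "T \<in> eta_plus_one" for S T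
  proof
    assume "S \<cong> T"
    then have "S \<in> eta_plus_one"
      using S T isomorphic_trans[of S T "order_sum order_eta order_one"] by (simp add: one_plus_eta_def eta_plus_one_def copies_def)
    \<comment> \<open>The least element has a finite lower cut, while all lower cuts are infinite in
      the other order.\<close>
    then show False using one_plus_eta_cuts[OF S] eta_plus_one_cuts(2) by blast
  qed
qed

section \<open>Reductions to equivalence structures\<close>

lemma two_class_sizes_E: "S \<in> E 1 \<Longrightarrow> two_class_sizes S 1" "S \<in> E 2 \<Longrightarrow> two_class_sizes S 2"
  by (simp_all add: two_class_sizesI)

lemma two_class_sizes_E_hat: "S \<in> E_hat 1 \<Longrightarrow> two_class_sizes S 1" "S \<in> E_hat 2 \<Longrightarrow> two_class_sizes S 2"
  by (simp_all add: two_class_sizesI)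

lemma infinite_pfst_label:
  assumes "x \<in> X" shows "infinite {l. pfst l \<in> X}"
proof -
  have "range (\<lambda>n. prod_encode (x, n)) \<subseteq> {l. pfst l \<in> X}" using assms by auto
  moreover have "infinite (range (\<lambda>n. prod_encode (x, n)))"
    by (rule range_inj_infinite) (simp add: inj_def)
  ultimately show ?thesis using infinite_super by blast
qed

subsection \<open>Infinitely many copies of every class\<close>

text \<open>A label is a pair \<open>(x, n)\<close> whose second component is free; it makes
  infinitely many copies of the class of \<open>x\<close>.\<close>

definition copy_classes :: "(nat \<times> nat) set \<Rightarrow> nat \<Rightarrow> bool" where
  "copy_classes r u \<longleftrightarrow> (pfst (pfst u), psnd u) \<in> r"

lemma (in two_class_sizes) restriction_copy_classes: "restriction copy_classes same_label S \<in> E_hat k"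
proof -
  have mem: "members copy_classes S l = rel S `` {pfst l}" for l
    by (auto simp: members_def copy_classes_def)
  obtain x where x: "x \<in> universe S" "infinite (rel S `` {x})" using infinite_class by blast
  obtain y where y: "y \<in> universe S" "finite (rel S `` {y})" using finite_class by blast
  show ?thesis
  proof (rule restriction_E_hat[OF k(1)], unfold mem)
    show "infinite {l. infinite (rel S `` {pfst l})}"
      using infinite_pfst_label[of x "{x. infinite (rel S `` {x})}"] x by simp
    show "infinite {l. finite (rel S `` {pfst l}) \<and> card (rel S `` {pfst l}) = k}"
      using infinite_pfst_label[of y "{y. finite (rel S `` {y}) \<and> card (rel S `` {y}) = k}"]
        y class_size[OF y] by simp
    show "card (rel S `` {pfst l}) = k" if "finite (rel S `` {pfst l})" "rel S `` {pfst l} \<noteq> {}" for l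
      using that class_size empty_class_iff by blast
  qed
qed

lemma E_reducible_E_hat: "(E 1, E 2) \<le>\<^sub>c (E_hat 1, E_hat 2)"
proof (rule reducible_c_restriction[OF isomorphism_types_E isomorphism_types_E_hat,
      where U = copy_classes and R = same_label])
  show "finitary (\<lambda>r. copy_classes r u)" for u
    unfolding copy_classes_def by (intro finitary_intros)
  show "decidable (\<lambda>e. copy_classes (decode_rel (pfst e)) (psnd e))"
    unfolding copy_classes_def by (intro computable_intros)
  show "decidable (\<lambda>e. same_label (pfst e) (psnd e))" by (intro computable_intros)
qed (use two_class_sizes.restriction_copy_classes[OF two_class_sizes_E(1)]
      two_class_sizes.restriction_copy_classes[OF two_class_sizes_E(2)] in auto)

subsection \<open>A single finite class\<close>

text \<open>The label \<open>(f, x)\<close> is the guess that \<open>x\<close> is the least element in a finite class and that \<open>f\<close> codes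
  the set of all smaller elements of the structure. It is issued once the elements of \<open>f\<close> are known to
  have infinite classes. When a smaller element is missing from \<open>f\<close>, the class is made infinite.\<close>

definition guess_least :: "(nat \<times> nat) set \<Rightarrow> nat \<Rightarrow> bool" where
  "guess_least r u \<longleftrightarrow> (psnd (pfst u), psnd (pfst u)) \<in> r \<and>
     (\<forall>z<pfst (pfst u). z \<in> set_decode (pfst (pfst u)) \<longrightarrow> z < psnd (pfst u) \<and> big r 2 z) \<and>
     ((psnd (pfst u), psnd u) \<in> r \<or>
      (\<exists>z<psnd (pfst u). \<not> z \<in> set_decode (pfst (pfst u)) \<and> (z, z) \<in> r))"

text \<open>The three outcomes are a guess that was refuted after being issued, one that still
  stands, and one that is never issued. The bound by \<open>f\<close> in the definition keeps the
  quantifier finite; it holds for all elements of the coded set by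
  \<open>set_decode_less\<close>.\<close>

lemma (in two_class_sizes) members_guess_least:
  "members guess_least S (prod_encode (f, x)) =
     (if x \<in> universe S \<and> (\<forall>z\<in>set_decode f. z < x \<and> z \<in> universe S \<and> infinite (rel S `` {z}))
      then if \<exists>z<x. z \<notin> set_decode f \<and> z \<in> universe S then UNIV else rel S `` {x} else {})"
proof -
  have "(\<forall>z<f. z \<in> set_decode f \<longrightarrow> z < x \<and> big (rel S) 2 z) \<longleftrightarrow>
      (\<forall>z\<in>set_decode f. z < x \<and> z \<in> universe S \<and> infinite (rel S `` {z}))"
    using big_iff[of 2] k set_decode_less by auto
  then show ?thesis by (auto simp: members_def guess_least_def refl_iff)
qed

lemma (in two_class_sizes) restriction_guess_least: "restriction guess_least same_label S \<in> E k"
proof (rule restriction_E[OF k(1)])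
  \<comment> \<open>The code 0 is the empty set, so these guesses are issued at once; with
    \<open>x\<close> in an infinite class, both the standing and the refuted guess have an infinite
    class.\<close>
  have "(\<lambda>x. prod_encode (0, x)) ` {x. (x, x) \<in> rel S \<and> infinite (rel S `` {x})}
      \<subseteq> {l. infinite (members guess_least S l)}"
    by (auto simp: members_guess_least refl_iff split: if_splits)
  moreover have "infinite ((\<lambda>x. prod_encode (0, x)) ` {x. (x, x) \<in> rel S \<and> infinite (rel S `` {x})})"
    using infinite_infinite_class by (subst finite_image_iff) (auto simp: inj_on_def)
  ultimately show "infinite {l. infinite (members guess_least S l)}" using infinite_super by blast
next
  show "card (members guess_least S l) = k"
    if l: "finite (members guess_least S l)" "members guess_least S l \<noteq> {}" for l
  proof -
    obtain f x where "l = prod_encode (f, x)" by (metis prod_decode_inverse surj_pair)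
    then show ?thesis using l class_size by (auto simp: members_guess_least split: if_splits)
  qed
next
  define P where "P x \<longleftrightarrow> x \<in> universe S \<and> finite (rel S `` {x})" for x
  define x\<^sub>0 where "x\<^sub>0 = (LEAST x. P x)"
  have "\<exists>x. P x" using finite_class by (auto simp: P_def)
  then have x0: "P x\<^sub>0" unfolding x\<^sub>0_def by (rule LeastI_ex)
  have below: "\<not> P z" if "z < x\<^sub>0" for z using not_less_Least that by (auto simp: x\<^sub>0_def)
  have fin: "finite {z \<in> universe S. z < x\<^sub>0}" by simp
  define f\<^sub>0 where "f\<^sub>0 = set_encode {z \<in> universe S. z < x\<^sub>0}"
  have f0: "set_decode f\<^sub>0 = {z \<in> universe S. z < x\<^sub>0}" by (simp add: f\<^sub>0_def)
  show "\<exists>!l. finite (members guess_least S l) \<and> card (members guess_least S l) = k"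
  proof (rule ex1I[of _ "prod_encode (f\<^sub>0, x\<^sub>0)"])
    show "finite (members guess_least S (prod_encode (f\<^sub>0, x\<^sub>0))) \<and>
        card (members guess_least S (prod_encode (f\<^sub>0, x\<^sub>0))) = k"
      using x0 below class_size by (auto simp: members_guess_least f0 P_def)
  next
    fix l assume l: "finite (members guess_least S l) \<and> card (members guess_least S l) = k"
    obtain f x where fx: "l = prod_encode (f, x)" by (metis prod_decode_inverse surj_pair)
    have f: "\<forall>z\<in>set_decode f. z < x \<and> z \<in> universe S \<and> infinite (rel S `` {z})"
      and all: "\<forall>z<x. z \<in> universe S \<longrightarrow> z \<in> set_decode f" and x: "P x"
      using l k(1) unfolding fx members_guess_least P_def by (auto split: if_splits)
    have "x\<^sub>0 \<le> x" using x unfolding x\<^sub>0_def by (rule Least_le)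
    \<comment> \<open>Otherwise \<open>f\<close>, being complete below \<open>x\<close>, would
      contain \<open>x\<^sub>0\<close>; but elements of an issued \<open>f\<close> have infinite
      classes.\<close>
    moreover have "\<not> x\<^sub>0 < x" using all f x0 by (auto simp: P_def)
    ultimately have "x = x\<^sub>0" by simp
    then have "set_decode f = set_decode f\<^sub>0" using f all by (auto simp: f0)
    then have "f = f\<^sub>0" by (metis set_decode_inverse)
    then show "l = prod_encode (f\<^sub>0, x\<^sub>0)" using fx \<open>x = x\<^sub>0\<close> by simp
  qed
qed

lemma E_hat_reducible_E: "(E_hat 1, E_hat 2) \<le>\<^sub>c (E 1, E 2)"
proof (rule reducible_c_restriction[OF isomorphism_types_E_hat isomorphism_types_E,
      where U = guess_least and R = same_label])
  show "finitary (\<lambda>r. guess_least r u)" for u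
    unfolding guess_least_def by (intro finitary_intros)
  show "decidable (\<lambda>e. guess_least (decode_rel (pfst e)) (psnd e))"
    unfolding guess_least_def by (intro computable_intros)
  show "decidable (\<lambda>e. same_label (pfst e) (psnd e))" by (intro computable_intros)
qed (use two_class_sizes.restriction_guess_least[OF two_class_sizes_E_hat(1)]
      two_class_sizes.restriction_guess_least[OF two_class_sizes_E_hat(2)] in auto)

subsection \<open>From orders to equivalence structures\<close>

text \<open>The labels \<open>(0, x, n)\<close> and \<open>(1, x, n)\<close> guess that \<open>x\<close> is the least and the greatest element,
  respectively; their classes grow with the set of elements below and above \<open>x\<close>.\<close>

definition endpoint_guess :: "(nat \<times> nat) set \<Rightarrow> nat \<Rightarrow> bool" where
  "endpoint_guess r u \<longleftrightarrow>
     pfst (pfst u) = 0 \<and> (psnd u, pfst (psnd (pfst u))) \<in> r \<or>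
     pfst (pfst u) = 1 \<and> pfst (psnd u) < 2 \<and> (pfst (psnd (pfst u)), psnd (psnd u)) \<in> r"

lemma members_endpoint_guess:
  "members endpoint_guess S l =
     (if pfst l = 0 then {y. (y, pfst (psnd l)) \<in> rel S}
      else if pfst l = 1 then prod_encode ` ({..<2} \<times> {y. (pfst (psnd l), y) \<in> rel S}) else {})"
proof (cases "pfst l = 1")
  case True
  have "y \<in> members endpoint_guess S l \<longleftrightarrow> y \<in> prod_encode ` ({..<2} \<times> {y. (pfst (psnd l), y) \<in> rel S})" for y
  proof -
    obtain a b where "y = prod_encode (a, b)" by (metis prod_decode_inverse surj_pair)
    then show ?thesis using True by (auto simp: members_def endpoint_guess_def)
  qed
  then show ?thesis using True by auto
qed (auto simp: members_def endpoint_guess_def)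

text \<open>The third component of a label is a free index, so a single endpoint yields infinitely
  many classes.\<close>

lemma infinite_labels:
  assumes "X \<noteq> {}" shows "infinite {l. pfst l = i \<and> pfst (psnd l) \<in> X}"
proof -
  obtain x where "x \<in> X" using assms by blast
  then have "range (\<lambda>n. prod_encode (i, prod_encode (x, n))) \<subseteq> {l. pfst l = i \<and> pfst (psnd l) \<in> X}" by auto
  moreover have "infinite (range (\<lambda>n. prod_encode (i, prod_encode (x, n))))"
    by (rule range_inj_infinite) (simp add: inj_def)
  ultimately show ?thesis using infinite_super by blast
qed

lemma finite_pairs_iff: "finite (prod_encode ` ({..<2} \<times> Y)) \<longleftrightarrow> finite Y"
  and card_pairs: "card (prod_encode ` ({..<2} \<times> Y)) = 2 * card Y"
proof -
  have "{..<2 :: nat} \<noteq> {}" by (simp add: lessThan_empty_iff)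
  then have "finite ({..<2 :: nat} \<times> Y) \<longleftrightarrow> finite Y"
    by (metis finite_SigmaI2 finite_cartesian_productD2 finite_cartesian_product finite_lessThan)
  moreover have "inj_on prod_encode A" for A by (simp add: inj_on_def)
  ultimately show "finite (prod_encode ` ({..<2} \<times> Y)) \<longleftrightarrow> finite Y"
    "card (prod_encode ` ({..<2} \<times> Y)) = 2 * card Y"
    by (simp_all add: finite_image_iff card_image card_cartesian_product)
qed

text \<open>Both orders are handled at once, with \<open>k\<close> recording which endpoint exists.
  A finite cut has one element, and the doubling of upper cuts turns it into a class of size
  2.\<close>

lemma restriction_endpoint_guess:
  assumes S: "is_struct S"
    and down: "\<And>x. x \<in> universe S \<Longrightarrow> finite {y. (y, x) \<in> rel S} \<Longrightarrow> card {y. (y, x) \<in> rel S} = 1 \<and> k = 1"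
    and up: "\<And>x. x \<in> universe S \<Longrightarrow> finite {y. (x, y) \<in> rel S} \<Longrightarrow> card {y. (x, y) \<in> rel S} = 1 \<and> k = 2"
    and ex: "(\<exists>x\<in>universe S. finite {y. (y, x) \<in> rel S}) \<or> (\<exists>x\<in>universe S. finite {y. (x, y) \<in> rel S})"
    and inf: "(\<exists>x\<in>universe S. infinite {y. (y, x) \<in> rel S}) \<or> (\<exists>x\<in>universe S. infinite {y. (x, y) \<in> rel S})"
  shows "restriction endpoint_guess same_label S \<in> E_hat k"
proof (rule restriction_E_hat)
  show "0 < k" using down up ex by fastforce
  have labels: "infinite {l. Q l}"
    if "x \<in> X" "\<And>l. pfst l = i \<Longrightarrow> pfst (psnd l) \<in> X \<Longrightarrow> Q l" for x X i and Q :: "nat \<Rightarrow> bool"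
  proof (rule infinite_super)
    show "infinite {l. pfst l = i \<and> pfst (psnd l) \<in> X}" using infinite_labels that(1) by blast
  qed (use that(2) in auto)
  from inf show "infinite {l. infinite (members endpoint_guess S l)}"
  proof
    assume "\<exists>x\<in>universe S. infinite {y. (y, x) \<in> rel S}"
    then obtain x where "x \<in> {x. infinite {y. (y, x) \<in> rel S}}" by blast
    then show ?thesis by (rule labels[where i = 0]) (simp add: members_endpoint_guess)
  next
    assume "\<exists>x\<in>universe S. infinite {y. (x, y) \<in> rel S}"
    then obtain x where "x \<in> {x. infinite {y. (x, y) \<in> rel S}}" by blast
    then show ?thesis by (rule labels[where i = 1]) (simp add: members_endpoint_guess finite_pairs_iff)
  qed
  from ex show "infinite {l. finite (members endpoint_guess S l) \<and> card (members endpoint_guess S l) = k}"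
  proof
    assume "\<exists>x\<in>universe S. finite {y. (y, x) \<in> rel S}"
    then obtain x where "x \<in> {x. x \<in> universe S \<and> finite {y. (y, x) \<in> rel S}}" by blast
    then show ?thesis by (rule labels[where i = 0]) (use down in \<open>auto simp: members_endpoint_guess\<close>)
  next
    assume "\<exists>x\<in>universe S. finite {y. (x, y) \<in> rel S}"
    then obtain x where "x \<in> {x. x \<in> universe S \<and> finite {y. (x, y) \<in> rel S}}" by blast
    then show ?thesis
      by (rule labels[where i = 1]) (use up in \<open>auto simp: members_endpoint_guess finite_pairs_iff card_pairs\<close>)
  qed
  fix l assume l: "finite (members endpoint_guess S l)" "members endpoint_guess S l \<noteq> {}"
  have "(x, y) \<in> rel S \<Longrightarrow> x \<in> universe S \<and> y \<in> universe S" for x y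
    using S by (auto simp: is_struct_def)
  then show "card (members endpoint_guess S l) = k"
    using l down up by (fastforce simp: members_endpoint_guess finite_pairs_iff card_pairs split: if_splits)
qed

lemma orders_reducible_E_hat: "(one_plus_eta, eta_plus_one) \<le>\<^sub>c (E_hat 1, E_hat 2)"
proof (rule reducible_c_restriction[OF isomorphism_types_orders isomorphism_types_E_hat,
      where U = endpoint_guess and R = same_label])
  show "finitary (\<lambda>r. endpoint_guess r u)" for u
    unfolding endpoint_guess_def by (intro finitary_intros)
  show "decidable (\<lambda>e. endpoint_guess (decode_rel (pfst e)) (psnd e))"
    unfolding endpoint_guess_def by (intro computable_intros)
  show "decidable (\<lambda>e. same_label (pfst e) (psnd e))" by (intro computable_intros)
  have struct: "is_struct S" if "S \<in> one_plus_eta \<union> eta_plus_one" for S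
    using isomorphism_types_orders that by (simp add: isomorphism_types_def)
  show "restriction endpoint_guess same_label S \<in> E_hat 1" if "S \<in> one_plus_eta" for S
  proof -
    obtain m where m: "m \<in> universe S" "finite {y. (y, m) \<in> rel S}" "card {y. (y, m) \<in> rel S} = 1"
      "\<And>x. x \<in> universe S \<Longrightarrow> x \<noteq> m \<Longrightarrow> infinite {y. (y, x) \<in> rel S}"
      using one_plus_eta_cuts(1)[OF \<open>S \<in> one_plus_eta\<close>] by blast
    have inf: "\<And>x. x \<in> universe S \<Longrightarrow> infinite {y. (x, y) \<in> rel S}"
      by (rule one_plus_eta_cuts(2)[OF that])
    show ?thesis
    proof (rule restriction_endpoint_guess)
      show "is_struct S" using struct that by blast
      show "card {y. (y, x) \<in> rel S} = 1 \<and> 1 = (1 :: nat)" if "x \<in> universe S" "finite {y. (y, x) \<in> rel S}" for x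
        using m(3,4) that by blast
    qed (use m(1,2) inf in blast)+
  qed
  show "restriction endpoint_guess same_label S \<in> E_hat 2" if "S \<in> eta_plus_one" for S
  proof -
    obtain m where m: "m \<in> universe S" "finite {y. (m, y) \<in> rel S}" "card {y. (m, y) \<in> rel S} = 1"
      "\<And>x. x \<in> universe S \<Longrightarrow> x \<noteq> m \<Longrightarrow> infinite {y. (x, y) \<in> rel S}"
      using eta_plus_one_cuts(1)[OF \<open>S \<in> eta_plus_one\<close>] by blast
    have inf: "\<And>x. x \<in> universe S \<Longrightarrow> infinite {y. (y, x) \<in> rel S}"
      by (rule eta_plus_one_cuts(2)[OF that])
    show ?thesis
    proof (rule restriction_endpoint_guess)
      show "is_struct S" using struct that by blast
      show "card {y. (x, y) \<in> rel S} = 1 \<and> 2 = (2 :: nat)" if "x \<in> universe S" "finite {y. (x, y) \<in> rel S}" for x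
        using m(3,4) that by blast
    qed (use m(1,2) inf in blast)+
  qed
qed

section \<open>From equivalence structures to orders\<close>

text \<open>Finite sets, given by their codes, are ordered lexicographically: at the first difference, the set
  with the element precedes. The nonempty sets form a dense order without endpoints.\<close>

definition precedes :: "nat \<Rightarrow> nat \<Rightarrow> bool" where
  "precedes a b \<longleftrightarrow> (\<exists>i<a. i \<in> set_decode a \<and> \<not> i \<in> set_decode b \<and>
     (\<forall>j<i. j \<in> set_decode a \<longleftrightarrow> j \<in> set_decode b))"

text \<open>The bound \<open>i < a\<close> serves decidability of \<open>precedes\<close> and is
  supplied here by \<open>set_decode_less\<close>.\<close>

lemma precedesI:
  assumes "i \<in> set_decode a" "i \<notin> set_decode b" "\<And>j. j < i \<Longrightarrow> j \<in> set_decode a \<longleftrightarrow> j \<in> set_decode b"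
  shows "precedes a b"
  unfolding precedes_def by (intro exI[of _ i]) (use assms set_decode_less in auto)

lemma precedesE:
  assumes "precedes a b"
  obtains i where "i \<in> set_decode a" "i \<notin> set_decode b"
    "\<forall>j<i. j \<in> set_decode a \<longleftrightarrow> j \<in> set_decode b"
  using assms unfolding precedes_def by blast

lemma precedes_irrefl: "\<not> precedes a a"
  by (auto simp: precedes_def)

lemma precedes_trans:
  assumes "precedes a b" "precedes b c" shows "precedes a c"
proof -
  obtain i where i: "i \<in> set_decode a" "i \<notin> set_decode b"
    "\<forall>l<i. l \<in> set_decode a \<longleftrightarrow> l \<in> set_decode b"
    using assms(1) by (rule precedesE)
  obtain j where j: "j \<in> set_decode b" "j \<notin> set_decode c"
    "\<forall>l<j. l \<in> set_decode b \<longleftrightarrow> l \<in> set_decode c"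
    using assms(2) by (rule precedesE)
  have "i \<noteq> j" using i j by blast
  then consider "i < j" | "j < i" by linarith
  then show ?thesis
  proof cases
    case 1
    then show ?thesis using i j by (intro precedesI[of i]) auto
  next
    case 2
    then show ?thesis using i j by (intro precedesI[of j]) auto
  qed
qed

lemma precedes_total:
  assumes "a \<noteq> b" shows "precedes a b \<or> precedes b a"
proof -
  define D where "D i \<longleftrightarrow> (i \<in> set_decode a) \<noteq> (i \<in> set_decode b)" for i
  have "set_decode a \<noteq> set_decode b" using assms by (metis set_decode_inverse)
  then have "\<exists>i. D i" by (auto simp: D_def)
  then have D: "D (LEAST i. D i)" (is "D ?i") by (rule LeastI_ex)
  have agree: "j \<in> set_decode a \<longleftrightarrow> j \<in> set_decode b" if "j < ?i" for j
    using not_less_Least[OF that] by (simp add: D_def)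
  show ?thesis
  proof (cases "?i \<in> set_decode a")
    case True
    then show ?thesis using D agree by (intro disjI1 precedesI[of ?i]) (simp_all add: D_def)
  next
    case False
    then show ?thesis using D agree by (intro disjI2 precedesI[of ?i]) (simp_all add: D_def)
  qed
qed

lemma set_encode_pos: "finite A \<Longrightarrow> A \<noteq> {} \<Longrightarrow> 0 < set_encode A"
  by (metis gr0I set_decode_zero set_encode_inverse)

text \<open>Adding an element moves a set down in the order, and an element beyond \<open>n\<close>
  leaves the initial part intact. The choice \<open>max n a\<close> is new because elements of a
  coded set are smaller than the code.\<close>

lemma precedes_extend: "\<exists>c>0. precedes c a \<and> (\<forall>i<n. i \<in> set_decode c \<longleftrightarrow> i \<in> set_decode a)"
proof -
  define j where "j = max n a"
  define c where "c = set_encode (insert j (set_decode a))"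
  have c: "set_decode c = insert j (set_decode a)" by (simp add: c_def)
  have j: "j \<notin> set_decode a" using set_decode_less[of j a] by (auto simp: j_def)
  have "precedes c a" by (rule precedesI[of j]) (use c j in auto)
  moreover have "0 < c" unfolding c_def by (rule set_encode_pos) auto
  moreover have "\<forall>i<n. i \<in> set_decode c \<longleftrightarrow> i \<in> set_decode a" by (auto simp: c j_def)
  ultimately show ?thesis by blast
qed

text \<open>Moving down from \<open>b\<close> while keeping all positions up to and including the
  first difference with \<open>a\<close>, hence the \<open>Suc i\<close>, cannot pass
  \<open>a\<close>.\<close>

lemma precedes_between:
  assumes "precedes a b" shows "\<exists>c>0. precedes a c \<and> precedes c b"
proof -
  obtain i where i: "i \<in> set_decode a" "i \<notin> set_decode b"
    "\<forall>l<i. l \<in> set_decode a \<longleftrightarrow> l \<in> set_decode b"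
    using assms by (rule precedesE)
  obtain c where c: "0 < c" "precedes c b" "\<forall>l<Suc i. l \<in> set_decode c \<longleftrightarrow> l \<in> set_decode b"
    using precedes_extend by blast
  have "precedes a c" by (rule precedesI[of i]) (use i c(3) in auto)
  then show ?thesis using c by blast
qed

text \<open>If \<open>i\<close> is the least element of the set, then \<open>{i + 1}\<close> comes
  later: position \<open>i\<close> is the first difference.\<close>

lemma precedes_above:
  assumes "0 < a" shows "\<exists>c>0. precedes a c"
proof -
  have "set_decode a \<noteq> {}" using assms by (metis less_irrefl set_decode_inverse set_encode_empty)
  then have "\<exists>i. i \<in> set_decode a" by blast
  then have i: "(LEAST i. i \<in> set_decode a) \<in> set_decode a" (is "?i \<in> _") by (rule LeastI_ex)
  have least: "j \<notin> set_decode a" if "j < ?i" for j using that by (rule not_less_Least)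
  have dec: "set_decode (set_encode {Suc ?i}) = {Suc ?i}" by (rule set_encode_inverse) simp
  have "precedes a (set_encode {Suc ?i})"
    by (rule precedesI[OF i]) (use least in \<open>auto simp only: dec\<close>)
  moreover have "0 < set_encode {Suc ?i}" by (rule set_encode_pos) auto
  ultimately show ?thesis by blast
qed

section \<open>Final segments and their mirrored sum\<close>

text \<open>The sum of a suborder of this order and the reverse of another one.\<close>

definition mirrored_sum_less_eq :: "nat \<Rightarrow> nat \<Rightarrow> bool" where
  "mirrored_sum_less_eq u v \<longleftrightarrow> pfst u < pfst v \<or> pfst u = pfst v \<and>
     (psnd u = psnd v \<or> pfst u = 0 \<and> precedes (psnd u) (psnd v) \<or>
      \<not> pfst u = 0 \<and> precedes (psnd v) (psnd u))"

text \<open>The empty set, with code 0, comes after all others. Leaving it out ensures that a final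
  segment has no greatest element.\<close>

definition up_closed :: "nat set \<Rightarrow> bool" where
  "up_closed X \<longleftrightarrow> X \<noteq> {} \<and> (\<forall>a\<in>X. 0 < a) \<and> (\<forall>a\<in>X. \<forall>b>0. precedes a b \<longrightarrow> b \<in> X)"

lemma up_closedD: "up_closed X \<Longrightarrow> a \<in> X \<Longrightarrow> 0 < b \<Longrightarrow> precedes a b \<Longrightarrow> b \<in> X"
  unfolding up_closed_def by blast

text \<open>The halves meet at their open ends: \<open>X\<close> has no greatest element and
  reversed \<open>Y\<close> has no least one. The sum is therefore dense, and its endpoints are the
  least elements of \<open>X\<close> and of \<open>Y\<close>, where they exist.\<close>

locale mirrored_sum =
  fixes X Y :: "nat set" and T :: "nat struct"
  assumes X: "up_closed X" and Y: "up_closed Y"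
    and universe: "universe T = {u. pfst u = 0 \<and> psnd u \<in> X \<or> pfst u = 1 \<and> psnd u \<in> Y}"
    and rel: "rel T = {(u, v). u \<in> universe T \<and> v \<in> universe T \<and> mirrored_sum_less_eq u v}"
begin

lemma universe_cases:
  assumes "u \<in> universe T"
  obtains a where "u = prod_encode (0, a)" "a \<in> X" | a where "u = prod_encode (1, a)" "a \<in> Y"
proof -
  obtain i a where "u = prod_encode (i, a)" by (metis prod_decode_inverse surj_pair)
  then show ?thesis using assms that by (auto simp: universe)
qed

lemma in_universe [simp]:
  "prod_encode (0, a) \<in> universe T \<longleftrightarrow> a \<in> X" "prod_encode (1, a) \<in> universe T \<longleftrightarrow> a \<in> Y"
  "prod_encode (Suc 0, a) \<in> universe T \<longleftrightarrow> a \<in> Y"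
  by (simp_all add: universe)

lemma rel_iff:
  "(prod_encode (i, a), prod_encode (j, b)) \<in> rel T \<longleftrightarrow>
     prod_encode (i, a) \<in> universe T \<and> prod_encode (j, b) \<in> universe T \<and>
     (i < j \<or> i = j \<and> (a = b \<or> i = 0 \<and> precedes a b \<or> i \<noteq> 0 \<and> precedes b a))"
  by (simp add: rel mirrored_sum_less_eq_def)

lemma dense_linear: "dense_linear T"
  unfolding dense_linear_def
proof (intro conjI ballI impI)
  have pair_eqI: "u = v" if "pfst u = pfst v" "psnd u = psnd v" for u v
    using that by (metis prod.expand prod_decode_eq)
  obtain a where "a \<in> X" using X by (auto simp: up_closed_def)
  then have "prod_encode (0, a) \<in> universe T" by simp
  then show "is_struct T" unfolding is_struct_def rel by blast
  show "refl_on (universe T) (rel T)" by (auto simp: refl_on_def rel mirrored_sum_less_eq_def)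
  show "antisym (rel T)"
  proof (rule antisymI)
    fix u v assume "(u, v) \<in> rel T" "(v, u) \<in> rel T"
    then have "pfst u = pfst v \<and> psnd u = psnd v"
      using precedes_trans[of "psnd u" "psnd v" "psnd u"] precedes_irrefl[of "psnd u"]
      unfolding rel mirrored_sum_less_eq_def by auto
    then show "u = v" using pair_eqI by blast
  qed
  show "trans (rel T)"
  proof (rule transI)
    fix u v w assume "(u, v) \<in> rel T" "(v, w) \<in> rel T"
    then show "(u, w) \<in> rel T"
      using precedes_trans[of "psnd u" "psnd v" "psnd w"] precedes_trans[of "psnd w" "psnd v" "psnd u"]
      unfolding rel mirrored_sum_less_eq_def by auto
  qed
  show "total_on (universe T) (rel T)"
  proof (rule total_onI)
    fix u v assume uv: "u \<in> universe T" "v \<in> universe T" "u \<noteq> v"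
    then have "pfst u \<noteq> pfst v \<or> psnd u \<noteq> psnd v" using pair_eqI by blast
    then show "(u, v) \<in> rel T \<or> (v, u) \<in> rel T"
      using uv precedes_total[of "psnd u" "psnd v"] unfolding rel mirrored_sum_less_eq_def by auto
  qed
  fix u v assume "u \<in> universe T" "v \<in> universe T" and uv: "(u, v) \<in> rel T \<and> u \<noteq> v"
  then show "\<exists>w\<in>universe T. (u, w) \<in> rel T \<and> (w, v) \<in> rel T \<and> w \<noteq> u \<and> w \<noteq> v"
  proof (elim universe_cases)
    fix a b assume ab: "u = prod_encode (0, a)" "a \<in> X" "v = prod_encode (0, b)" "b \<in> X"
    then have "precedes a b" using uv by (auto simp: rel_iff)
    then obtain c where c: "0 < c" "precedes a c" "precedes c b" using precedes_between by blast
    have "c \<in> X" by (rule up_closedD[OF X ab(2) c(1,2)])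
    then show ?thesis using ab c precedes_irrefl
      by (intro bexI[of _ "prod_encode (0, c)"]) (auto simp: rel_iff)
  next
    fix a b assume ab: "u = prod_encode (0, a)" "a \<in> X" "v = prod_encode (1, b)" "b \<in> Y"
    have "0 < a" using X ab(2) by (auto simp: up_closed_def)
    \<comment> \<open>Between the two halves it suffices to move up within the lower one.\<close>
    then obtain c where c: "0 < c" "precedes a c" using precedes_above by blast
    have "c \<in> X" by (rule up_closedD[OF X ab(2) c])
    then show ?thesis using ab c precedes_irrefl
      by (intro bexI[of _ "prod_encode (0, c)"]) (auto simp: rel_iff)
  next
    fix a b assume "u = prod_encode (1, a)" "v = prod_encode (0, b)"
    then show ?thesis using uv by (simp add: rel_iff)
  next
    fix a b assume ab: "u = prod_encode (1, a)" "a \<in> Y" "v = prod_encode (1, b)" "b \<in> Y"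
    then have "precedes b a" using uv by (auto simp: rel_iff)
    then obtain c where c: "0 < c" "precedes b c" "precedes c a" using precedes_between by blast
    have "c \<in> Y" by (rule up_closedD[OF Y ab(4) c(1,2)])
    then show ?thesis using ab c precedes_irrefl
      by (intro bexI[of _ "prod_encode (1, c)"]) (auto simp: rel_iff)
  qed
qed

lemma one_plus_eta:
  assumes a: "a \<in> X" "\<And>b. b \<in> X \<Longrightarrow> a = b \<or> precedes a b"
    and Y': "\<And>b. b \<in> Y \<Longrightarrow> \<exists>c\<in>Y. precedes c b"
  shows "T \<in> one_plus_eta"
proof (rule one_plus_etaI[OF dense_linear])
  show "prod_encode (0, a) \<in> universe T" using a by simp
  fix u assume u: "u \<in> universe T"
  then show "(prod_encode (0, a), u) \<in> rel T"
    using a by (elim universe_cases) (auto simp: rel_iff)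
  from u show "\<exists>v\<in>universe T. (u, v) \<in> rel T \<and> u \<noteq> v"
  proof (cases rule: universe_cases)
    case (1 b)
    obtain c where "c \<in> Y" using Y by (auto simp: up_closed_def)
    then show ?thesis using 1 by (intro bexI[of _ "prod_encode (1, c)"]) (auto simp: rel_iff)
  next
    case (2 b)
    then obtain c where "c \<in> Y" "precedes c b" using Y' by blast
    then show ?thesis using 2 precedes_irrefl
      by (intro bexI[of _ "prod_encode (1, c)"]) (auto simp: rel_iff)
  qed
qed

lemma eta_plus_one:
  assumes a: "a \<in> Y" "\<And>b. b \<in> Y \<Longrightarrow> a = b \<or> precedes a b"
    and X': "\<And>b. b \<in> X \<Longrightarrow> \<exists>c\<in>X. precedes c b"
  shows "T \<in> eta_plus_one"
proof (rule eta_plus_oneI[OF dense_linear])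
  show "prod_encode (1, a) \<in> universe T" using a by simp
  fix u assume u: "u \<in> universe T"
  then show "(u, prod_encode (1, a)) \<in> rel T"
    using a by (elim universe_cases) (auto simp: rel_iff)
  from u show "\<exists>v\<in>universe T. (v, u) \<in> rel T \<and> u \<noteq> v"
  proof (cases rule: universe_cases)
    case (1 b)
    then obtain c where "c \<in> X" "precedes c b" using X' by blast
    then show ?thesis using 1 precedes_irrefl
      by (intro bexI[of _ "prod_encode (0, c)"]) (auto simp: rel_iff)
  next
    case (2 b)
    obtain c where "c \<in> X" using X by (auto simp: up_closed_def)
    then show ?thesis using 2 by (intro bexI[of _ "prod_encode (0, c)"]) (auto simp: rel_iff)
  qed
qed

end

section \<open>Guesses at a finite class and their cones\<close>

text \<open>As for \<^const>\<open>guess_least\<close>, a pair \<open>(F, x)\<close> is the guess that \<open>x\<close> is the least element in a finite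
  class and \<open>F\<close> the set of smaller elements. It is coded by \<open>a = {2 y | y \<in> F} \<union> {2 x + 1}\<close>. With this
  coding a correct guess precedes all other guesses that are issued. The guess \<open>a\<close> contributes all sets
  from \<open>a\<close> upwards; when it is refuted, it also contributes all sets that extend \<open>a\<close>, which has the
  effect that there is no least set any more.\<close>

definition guess :: "(nat \<times> nat) set \<Rightarrow> nat \<Rightarrow> nat \<Rightarrow> bool" where
  "guess r x a \<longleftrightarrow> 2 * x + 1 \<in> set_decode a \<and> \<not> 2 * x \<in> set_decode a \<and>
     (\<forall>y<x. \<not> 2 * y + 1 \<in> set_decode a \<and> (2 * y \<in> set_decode a \<longrightarrow> big r 2 y))"

text \<open>The index \<open>j\<close> stands for class size \<open>Suc j\<close>: a guess is issued
  once \<open>big r j x\<close> shows at least \<open>Suc j\<close> elements and refuted when there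
  are more.\<close>

definition refuted :: "(nat \<times> nat) set \<Rightarrow> nat \<Rightarrow> nat \<Rightarrow> nat \<Rightarrow> bool" where
  "refuted r j x a \<longleftrightarrow> big r (Suc j) x \<or> (\<exists>y<x. \<not> 2 * y \<in> set_decode a \<and> (y, y) \<in> r)"

text \<open>The quantifiers are arranged for decidability: \<open>(x, x) \<in> r\<close> bounds
  \<open>x\<close> on a finite relation, and the bound on \<open>a\<close> says that
  \<open>2 * x + 1\<close> is its largest possible element, so that \<open>a\<close> is exactly the
  guess.\<close>

definition cone :: "(nat \<times> nat) set \<Rightarrow> nat \<Rightarrow> nat \<Rightarrow> bool" where
  "cone r j c \<longleftrightarrow> 0 < c \<and> (\<exists>x. (x, x) \<in> r \<and> big r j x \<and> (\<exists>a<2 ^ (2 * x + 2). guess r x a \<and>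
     (a = c \<or> precedes a c \<or>
      refuted r j x a \<and> (\<forall>i<2 * x + 2. i \<in> set_decode c \<longleftrightarrow> i \<in> set_decode a))))"

definition cones :: "(nat \<times> nat) set \<Rightarrow> nat \<Rightarrow> bool" where
  "cones r u \<longleftrightarrow> pfst u < 2 \<and> cone r (pfst u) (psnd u)"

lemma set_decode_bounded:
  assumes "a < 2 ^ n" "i \<in> set_decode a" shows "i < n"
proof -
  have "2 ^ i \<le> a" using assms(2) by (rule set_decode_power_le)
  also note assms(1)
  finally show ?thesis by (rule power_less_imp_less_exp[rotated]) simp
qed

lemma set_encode_bounded:
  assumes "A \<subseteq> {..<n}" shows "set_encode A < 2 ^ n"
proof -
  have "set_encode A \<le> sum ((^) 2) {0..<n}"
    unfolding set_encode_def by (rule sum_mono2) (use assms in auto)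
  also have "\<dots> < 2 ^ n" by (simp add: sum_power2)
  finally show ?thesis .
qed

context two_class_sizes
begin

lemma up_closed_cone:
  assumes "j < 2" shows "up_closed {c. cone (rel S) j c}"
  unfolding up_closed_def
proof (intro conjI ballI allI impI)
  obtain x where x: "x \<in> universe S" "infinite (rel S `` {x})" using infinite_class by blast
  \<comment> \<open>The guess with \<open>F\<close> empty is issued immediately, and an infinite
    class of \<open>x\<close> passes \<open>big\<close> for either \<open>j\<close>.\<close>
  define a where "a = set_encode {2 * x + 1}"
  have dec: "set_decode a = {2 * x + 1}" unfolding a_def by (rule set_encode_inverse) simp
  have "guess (rel S) x a" by (auto simp: guess_def dec)
  moreover have "a < 2 ^ (2 * x + 2)" unfolding a_def by (rule set_encode_bounded) auto
  moreover have "0 < a" unfolding a_def by (rule set_encode_pos) auto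
  moreover have "big (rel S) j x" using big_iff[of j x] x assms by auto
  ultimately have "cone (rel S) j a" using x refl_iff unfolding cone_def by blast
  then show "{c. cone (rel S) j c} \<noteq> {}" by blast
next
  fix c assume "c \<in> {c. cone (rel S) j c}" then show "0 < c" by (simp add: cone_def)
next
  fix c d assume "c \<in> {c. cone (rel S) j c}" and d: "0 < d" "precedes c d"
  then obtain x a where x: "(x, x) \<in> rel S" "big (rel S) j x" "a < 2 ^ (2 * x + 2)" "guess (rel S) x a"
    and c: "a = c \<or> precedes a c \<or>
      refuted (rel S) j x a \<and> (\<forall>i<2 * x + 2. i \<in> set_decode c \<longleftrightarrow> i \<in> set_decode a)"
    unfolding cone_def by blast
  have "precedes a d \<or>
      refuted (rel S) j x a \<and> (\<forall>i<2 * x + 2. i \<in> set_decode d \<longleftrightarrow> i \<in> set_decode a)"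
    using c
  proof (elim disjE)
    assume agree: "refuted (rel S) j x a \<and> (\<forall>i<2 * x + 2. i \<in> set_decode c \<longleftrightarrow> i \<in> set_decode a)"
    obtain i where i: "i \<in> set_decode c" "i \<notin> set_decode d"
      "\<forall>l<i. l \<in> set_decode c \<longleftrightarrow> l \<in> set_decode d"
      using d(2) by (rule precedesE)
    show ?thesis
    \<comment> \<open>If the first difference between \<open>c\<close> and \<open>d\<close> lies in
      the part shared with \<open>a\<close>, then \<open>a\<close> precedes \<open>d\<close>;
      otherwise \<open>d\<close> extends \<open>a\<close> as well.\<close>
    proof (cases "i < 2 * x + 2")
      case True
      then have "precedes a d" by (intro precedesI[of i]) (use agree i in auto)
      then show ?thesis ..
    next
      case False
      then show ?thesis using agree i(3) by auto
    qed
  qed (use d precedes_trans in blast)+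
  then show "d \<in> {c. cone (rel S) j c}" using x d(1) unfolding cone_def by blast
qed

lemma cone_no_least:
  assumes j: "j < 2" "Suc j \<noteq> k" and c: "cone (rel S) j c"
  shows "\<exists>d. cone (rel S) j d \<and> precedes d c"
proof -
  obtain x a where x: "(x, x) \<in> rel S" "big (rel S) j x" "a < 2 ^ (2 * x + 2)" "guess (rel S) x a"
    and a: "a = c \<or> precedes a c \<or>
      refuted (rel S) j x a \<and> (\<forall>i<2 * x + 2. i \<in> set_decode c \<longleftrightarrow> i \<in> set_decode a)"
    using c unfolding cone_def by blast
  \<comment> \<open>Finite classes have size \<open>k \<noteq> Suc j\<close>, so a class with at
    least \<open>Suc j\<close> elements has more: every guess issued with this \<open>j\<close> is
    refuted.\<close>
  have "big (rel S) (Suc j) x" using x(2) j big_iff[of j x] big_iff[of "Suc j" x] by auto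
  then have ref: "refuted (rel S) j x a" by (simp add: refuted_def)
  consider "precedes a c" | "\<forall>i<2 * x + 2. i \<in> set_decode c \<longleftrightarrow> i \<in> set_decode a" using a by blast
  then show ?thesis
  proof cases
    case 1
    then obtain d where "0 < d" "precedes a d" "precedes d c" using precedes_between by blast
    then show ?thesis using x unfolding cone_def by blast
  next
    case 2
    obtain d where "0 < d" "precedes d c" "\<forall>i<2 * x + 2. i \<in> set_decode d \<longleftrightarrow> i \<in> set_decode c"
      using precedes_extend by blast
    moreover from this have "\<forall>i<2 * x + 2. i \<in> set_decode d \<longleftrightarrow> i \<in> set_decode a" using 2 by simp
    ultimately show ?thesis using x ref unfolding cone_def by blast
  qed
qed

text \<open>Compare the correct guess \<open>A\<close> with another issued guess \<open>b\<close> at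
  the first block \<open>{2 * z, 2 * z + 1}\<close> where they differ. Below \<open>x\<close>,
  \<open>A\<close> contains \<open>2 * z\<close> for every element \<open>z\<close> of the
  structure, so \<open>b\<close> can only lack one. At \<open>x\<close> itself \<open>b\<close>
  cannot contain \<open>2 * x\<close>, since the class of \<open>x\<close> is finite, and it lacks
  \<open>2 * x + 1\<close> if its own guess lies higher. Either way \<open>A\<close> has the first
  extra element and comes first.\<close>

lemma cone_least:
  assumes j: "Suc j = k"
  shows "\<exists>a. cone (rel S) j a \<and> (\<forall>c. cone (rel S) j c \<longrightarrow> a = c \<or> precedes a c)"
proof -
  define P where "P x \<longleftrightarrow> x \<in> universe S \<and> finite (rel S `` {x})" for x
  define x where "x = (LEAST x. P x)"
  have "\<exists>x. P x" using finite_class by (auto simp: P_def)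
  then have x: "P x" unfolding x_def by (rule LeastI_ex)
  have below: "\<not> P z" if "z < x" for z using not_less_Least that by (auto simp: x_def)
  define A where "A = insert (2 * x + 1) ((*) 2 ` {y \<in> universe S. y < x})"
  define a where "a = set_encode A"
  have "finite A" by (simp add: A_def)
  then have dec: "set_decode a = A" by (simp add: a_def)
  have even: "2 * y \<in> A \<longleftrightarrow> y \<in> universe S \<and> y < x" for y
  proof -
    have "2 * y \<noteq> 2 * x + 1" by presburger
    then show ?thesis by (auto simp: A_def)
  qed
  have odd: "2 * y + 1 \<in> A \<longleftrightarrow> y = x" for y
    unfolding A_def by (auto; presburger)
  have big2: "big (rel S) 2 y \<longleftrightarrow> y \<in> universe S \<and> \<not> P y" for y
    using big_iff[of 2 y] k by (auto simp: P_def)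
  have "guess (rel S) x a"
    unfolding guess_def dec even odd big2 using below by auto
  moreover have a: "a < 2 ^ (2 * x + 2)" unfolding a_def by (rule set_encode_bounded) (auto simp: A_def)
  moreover have "0 < a" unfolding a_def by (rule set_encode_pos) (auto simp: A_def)
  moreover have "big (rel S) j x" using big_iff[of j x] x j k by (auto simp: P_def)
  ultimately have "cone (rel S) j a" using x refl_iff unfolding cone_def P_def by blast
  moreover have "a = c \<or> precedes a c" if "cone (rel S) j c" for c
  proof -
    obtain y b where y: "(y, y) \<in> rel S" "b < 2 ^ (2 * y + 2)" "guess (rel S) y b"
      and c: "b = c \<or> precedes b c \<or>
        refuted (rel S) j y b \<and> (\<forall>i<2 * y + 2. i \<in> set_decode c \<longleftrightarrow> i \<in> set_decode b)"
      using \<open>cone (rel S) j c\<close> unfolding cone_def by blast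
    have yS: "y \<in> universe S" using y(1) refl_iff by simp
    have b: "2 * y + 1 \<in> set_decode b" "2 * y \<notin> set_decode b"
      "\<And>z. z < y \<Longrightarrow> 2 * z + 1 \<notin> set_decode b"
      "\<And>z. z < y \<Longrightarrow> 2 * z \<in> set_decode b \<Longrightarrow> z \<in> universe S \<and> \<not> P z"
      using y(3) unfolding guess_def big2 by blast+
    define D where "D z \<longleftrightarrow> (2 * z \<in> A) \<noteq> (2 * z \<in> set_decode b) \<or> (2 * z + 1 \<in> A) \<noteq> (2 * z + 1 \<in> set_decode b)" for z
    show ?thesis
    proof (cases "\<exists>z. z \<le> x \<and> z \<le> y \<and> D z")
      case True
      define n where "n = (LEAST z. z \<le> x \<and> z \<le> y \<and> D z)"
      have n: "n \<le> x" "n \<le> y" "D n" using LeastI_ex[OF True] by (auto simp: n_def)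
      have agree: "\<not> D z" if "z < n" for z
        using not_less_Least[of z "\<lambda>z. z \<le> x \<and> z \<le> y \<and> D z"] that n(1,2) by (auto simp: n_def)
      have agree2: "l \<in> A \<longleftrightarrow> l \<in> set_decode b" if "l < 2 * n" for l
      proof -
        have "l = 2 * (l div 2) \<or> l = 2 * (l div 2) + 1" by presburger
        moreover have "\<not> D (l div 2)" using agree that by simp
        ultimately show ?thesis unfolding D_def by metis
      qed
      \<comment> \<open>The bound on the position matters: a set that agrees with \<open>b\<close>
        below \<open>2 * y + 2\<close> is then preceded by \<open>a\<close> for the same reason as
        \<open>b\<close>.\<close>
      have "\<exists>i<2 * y + 2. i \<in> A \<and> i \<notin> set_decode b \<and> (\<forall>l<i. l \<in> A \<longleftrightarrow> l \<in> set_decode b)"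
      proof (cases "n < x")
        case True
        have "n \<in> universe S"
          using n(2,3) True b yS unfolding D_def even odd by (cases "n = y") auto
        then have "2 * n \<in> A" using True even by simp
        moreover have "2 * n \<notin> set_decode b"
        proof (cases "n = y")
          case False
          then show ?thesis using n(2,3) True b(3)[of n] \<open>n \<in> universe S\<close> unfolding D_def even odd by auto
        qed (use b(2) in simp)
        ultimately show ?thesis using agree2 n(2) by (intro exI[of _ "2 * n"]) auto
      next
        case False
        then have "n = x" using n(1) by simp
        have "n \<noteq> y" using n(3) b(1,2) unfolding D_def even odd \<open>n = x\<close> by auto
        then have "n < y" using n(2) by simp
        then have "2 * x \<notin> set_decode b" "2 * x + 1 \<notin> set_decode b"
          using b(3,4)[of x] x \<open>n = x\<close> by auto
        moreover have "2 * x \<notin> A" "2 * x + 1 \<in> A" using even[of x] odd[of x] by auto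
        ultimately show ?thesis using agree2 \<open>n = x\<close> \<open>n < y\<close>
          by (intro exI[of _ "2 * x + 1"]) (auto simp: less_Suc_eq)
      qed
      then obtain i where i: "i < 2 * y + 2" "i \<in> A" "i \<notin> set_decode b"
        "\<forall>l<i. l \<in> A \<longleftrightarrow> l \<in> set_decode b" by blast
      then have ab: "precedes a b" by (intro precedesI[of i]) (auto simp: dec)
      from c show ?thesis
      proof (elim disjE)
        assume "refuted (rel S) j y b \<and> (\<forall>i<2 * y + 2. i \<in> set_decode c \<longleftrightarrow> i \<in> set_decode b)"
        then have "precedes a c" using i by (intro precedesI[of i]) (auto simp: dec)
        then show ?thesis ..
      qed (use ab precedes_trans in blast)+
    next
      case False
      have xy: "x = y"
      proof (rule ccontr)
        assume "x \<noteq> y"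
        then consider "x < y" | "y < x" by linarith
        then show False
        proof cases
          case 1
          then have "D x" using b(3)[of x] odd[of x] by (simp add: D_def)
          then show False using False 1 by auto
        next
          case 2
          then have "D y" using b(1) odd[of y] by (simp add: D_def)
          then show False using False 2 by auto
        qed
      qed
      have "l \<in> A \<longleftrightarrow> l \<in> set_decode b" for l
      proof (cases "l < 2 * x + 2")
        case True
        then have "\<not> D (l div 2)" using False xy by auto
        moreover have "l = 2 * (l div 2) \<or> l = 2 * (l div 2) + 1" by presburger
        ultimately show ?thesis unfolding D_def by metis
      next
        case False
        then show ?thesis
          using set_decode_bounded[OF a] set_decode_bounded[OF y(2)] xy by (auto simp: dec)
      qed
      then have "A = set_decode b" by blast
      then have ab: "a = b" by (simp add: a_def)
      \<comment> \<open>The correct guess is never refuted: its class has exactly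
        \<open>Suc j\<close> elements and \<open>A\<close> omits no smaller element. So the sets
        extending it are not added.\<close>
      have "\<not> big (rel S) (Suc j) y" using big_iff[of "Suc j" y] x j k xy by (auto simp: P_def)
      then have "\<not> refuted (rel S) j y b"
        unfolding refuted_def refl_iff xy[symmetric] ab[symmetric] dec even by auto
      then show ?thesis using c ab by blast
    qed
  qed
  ultimately show ?thesis by blast
qed

lemma mirrored_sum_cones:
  "mirrored_sum {c. cone (rel S) 0 c} {c. cone (rel S) 1 c} (restriction cones mirrored_sum_less_eq S)"
  using up_closed_cone[of 0] up_closed_cone[of 1]
  by unfold_locales (auto simp: restriction_def cones_def less_2_cases_iff)

end

lemma restriction_cones_1:
  assumes "S \<in> E_hat 1" shows "restriction cones mirrored_sum_less_eq S \<in> one_plus_eta"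
proof -
  interpret two_class_sizes S 1 using assms by (rule two_class_sizes_E_hat)
  interpret sum: mirrored_sum "{c. cone (rel S) 0 c}" "{c. cone (rel S) 1 c}"
    "restriction cones mirrored_sum_less_eq S" by (rule mirrored_sum_cones)
  obtain a where "cone (rel S) 0 a" "\<forall>c. cone (rel S) 0 c \<longrightarrow> a = c \<or> precedes a c"
    using cone_least[of 0] by auto
  then show ?thesis using cone_no_least[of 1] by (intro sum.one_plus_eta[of a]) auto
qed

lemma restriction_cones_2:
  assumes "S \<in> E_hat 2" shows "restriction cones mirrored_sum_less_eq S \<in> eta_plus_one"
proof -
  interpret two_class_sizes S 2 using assms by (rule two_class_sizes_E_hat)
  interpret sum: mirrored_sum "{c. cone (rel S) 0 c}" "{c. cone (rel S) 1 c}"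
    "restriction cones mirrored_sum_less_eq S" by (rule mirrored_sum_cones)
  obtain a where "cone (rel S) 1 a" "\<forall>c. cone (rel S) 1 c \<longrightarrow> a = c \<or> precedes a c"
    using cone_least[of 1] by auto
  then show ?thesis using cone_no_least[of 0] by (intro sum.eta_plus_one[of a]) auto
qed

lemma E_hat_reducible_orders: "(E_hat 1, E_hat 2) \<le>\<^sub>c (one_plus_eta, eta_plus_one)"
proof (rule reducible_c_restriction[OF isomorphism_types_E_hat isomorphism_types_orders,
      where U = cones and R = mirrored_sum_less_eq])
  show "finitary (\<lambda>r. cones r u)" for u
    unfolding cones_def cone_def guess_def refuted_def by (intro finitary_intros)
  show "decidable (\<lambda>e. cones (decode_rel (pfst e)) (psnd e))"
    unfolding cones_def cone_def guess_def refuted_def precedes_def by (intro computable_intros)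
  show "decidable (\<lambda>e. mirrored_sum_less_eq (pfst e) (psnd e))"
    unfolding mirrored_sum_less_eq_def precedes_def by (intro computable_intros)
qed (rule restriction_cones_1 restriction_cones_2; assumption)+

theorem theorem4p9:
  shows "(one_plus_eta, eta_plus_one) \<equiv>\<^sub>c (E_hat 1, E_hat 2) \<and>
         (E_hat 1, E_hat 2) \<equiv>\<^sub>c (E 1, E 2)"
  unfolding equivalent_c_def
  using orders_reducible_E_hat E_hat_reducible_orders E_hat_reducible_E E_reducible_E_hat by blast

end
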